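(* Fix $\rho\in(0,\lambda_0)$ and put $\mu_i=\sqrt{\lambda_i^2-\rho^2}>0$ for $i=1,\dots,n$. Let $Q$ be an $n\times n$ complex symmetric matrix and let $\tilde\psi_0(z)=\exp(-\langle z,Qz\rangle)$. Then the following two assertions are equivalent. (A) There is a complex $n\times n$ matrix $R=[r_{ij}]$ such that, with $\Lambda_i=\frac{\partial}{\partial z_i}+\sum_{j=1}^n r_{ij}z_j$ ($i=1,\dots,n$), both of the following conditions hold: Condition 1: there exists $\delta>0$ such that $\langle z,\Phi''_{z\bar z}\bar z\rangle+\operatorname{Re}\langle z,(\Phi''_{zz}+Q)z\rangle\ge\delta|z|^2$ for all $z\in\mathbb C^n$; Condition 2: (i) $\Lambda_i\tilde\psi_0=0$ for $i=1,\dots,n$; (ii) $[\Lambda_i,\Lambda_j]=0$ for $i,j=1,\dots,n$; (iii) $[\Lambda_i,\Lambda_j^*]=2\rho^2\delta_{ij}$ for $i,j=1,\dots,n$ ($\delta_{ij}$ the Kronecker delta). (B) There exists an $n\times n$ unitary matrix $X$ satisfying $${}^tX\operatorname{diag}\Bigl(\tfrac{\mu_1}{\lambda_1},\dots,\tfrac{\mu_n}{\lambda_n}\Bigr)=\operatorname{diag}\Bigl(\tfrac{\mu_1}{\lambda_1},\dots,\tfrac{\mu_n}{\lambda_n}\Bigr)X$$ such that $$Q=-\Phi''_{zz}+U\operatorname{diag}(\mu_1,\dots,\mu_n)\,X\operatorname{diag}(\lambda_1,\dots,\lambda_n)\,{}^tU .$$ In this case $R=2Q$, that is, $\Lambda=\frac{\partial}{\partial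 z}+2Qz$.
   Context: Let $n\ge 1$. For column vectors $z,\zeta\in\mathbb C^n$ write $\langle z,\zeta\rangle=\sum_{j}z_j\zeta_j$ (bilinear, no conjugation) and $|z|^2=\sum_j z_j\overline{z_j}$. For a matrix $M$, ${}^tM$ is the transpose, $\overline M$ the entrywise conjugate, $M^*={}^t\overline M$; $E$ is the identity matrix. Fix complex $n\times n$ matrices $A,B,C$ with ${}^tA=A$, $\det B\ne0$, ${}^tC=C$ and $C_I=\frac{C-\overline C}{2\sqrt{-1}}$ positive definite. Set $$\Phi''_{z\bar z}=\tfrac14 BC_I^{-1}B^*,\qquad \Phi''_{zz}=-\tfrac14BC_I^{-1}\,{}^tB-\tfrac{A}{2\sqrt{-1}},\qquad \Phi(z)=\langle z,\Phi''_{z\bar z}\bar z\rangle+\operatorname{Re}\langle z,\Phi''_{zz}z\rangle .$$ $\Phi''_{z\bar z}$ is positive definite Hermitian, $\Phi''_{zz}$ is complex symmetric. $\mathscr H_\Phi(\mathbb C^n)$ is the Hilbert space of entire functions $F$ on $\mathbb C^n$ with $\int|F|^2e^{-2\Phi}L(dz)<\infty$ ($L$ Lebesgue measure), with inner product $(F,G)=\int_{\mathbb C^n}F\overline Ge^{-2\Phi}L(dz)$. The eigenvalues of $\Phi''_{z\bar z}$ (with multiplicity) are $\lambda_1^2,\dots,\lambda_n^2$ with $\lambda_i>0$; $\lambda_0=\min_i\lambda_i$; $U$ is a fixed $n\times n$ unitary matrix with $U^*\Phi''_{z\bar z}U=\operatorname{diag}(\lambda_1^2,\dots,\lambda_n^2)$.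 Operators act on entire functions, and $[P,P']=PP'-P'P$. For $\Lambda_i=\frac{\partial}{\partial z_i}+\sum_j r_{ij}z_j$, $\Lambda_i^*$ denotes its adjoint in $\mathscr H_\Phi(\mathbb C^n)$, understood as the differential operator: the unique operator of the form $\sum_k a_k\frac{\partial}{\partial z_k}+\sum_k b_kz_k+c$ with complex constants $a_k,b_k,c$ such that $(\Lambda_iF,G)=(F,\Lambda_i^*G)$ for all $F,G\in\mathscr H_\Phi(\mathbb C^n)$ with $z_kF,\ \partial F/\partial z_k,\ z_kG,\ \partial G/\partial z_k\in\mathscr H_\Phi(\mathbb C^n)$ for all $k$. *)

theory Defs
  imports "HOL-Analysis.Analysis"
begin

subsection \<open>Complex vectors and matrices\<close>

text \<open>The bilinear (not sesquilinear) pairing; \<open>inner\<close> on \<open>complex ^ 'n\<close> is the real inner product.\<close>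

definition bilin :: "complex ^ 'n \<Rightarrow> complex ^ 'n \<Rightarrow> complex" where
  "bilin z w = (\<Sum>j\<in>UNIV. z $ j * w $ j)"

definition cnj_vec :: "complex ^ 'n \<Rightarrow> complex ^ 'n" where
  "cnj_vec z = (\<chi> j. cnj (z $ j))"

definition cnj_mat :: "complex ^ 'n ^ 'm \<Rightarrow> complex ^ 'n ^ 'm" where
  "cnj_mat M = (\<chi> i j. cnj (M $ i $ j))"

definition conj_transpose :: "complex ^ 'n ^ 'm \<Rightarrow> complex ^ 'm ^ 'n" where
  "conj_transpose M = transpose (cnj_mat M)"

definition scale_mat :: "complex \<Rightarrow> complex ^ 'n ^ 'm \<Rightarrow> complex ^ 'n ^ 'm" where
  "scale_mat c M = (\<chi> i j. c * M $ i $ j)"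

definition diag_mat :: "('n \<Rightarrow> real) \<Rightarrow> complex ^ 'n ^ 'n" where
  "diag_mat d = (\<chi> i j. if i = j then complex_of_real (d i) else 0)"

definition unitary_mat :: "complex ^ 'n ^ 'n \<Rightarrow> bool" where
  "unitary_mat U \<longleftrightarrow> conj_transpose U ** U = mat 1 \<and> U ** conj_transpose U = mat 1"

text \<open>For a Hermitian \<open>M\<close> the form below is real, so \<open>Re\<close> discards nothing.\<close>

definition pos_def_mat :: "complex ^ 'n ^ 'n \<Rightarrow> bool" where
  "pos_def_mat M \<longleftrightarrow>
     conj_transpose M = M \<and> (\<forall>z. z \<noteq> 0 \<longrightarrow> 0 < Re (bilin (cnj_vec z) (M *v z)))"

definition im_mat :: "complex ^ 'n ^ 'n \<Rightarrow> complex ^ 'n ^ 'n" where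
  "im_mat C = scale_mat (1 / (2 * \<i>)) (C - cnj_mat C)"


subsection \<open>The weight\<close>

definition Phi_zzbar :: "complex ^ 'n ^ 'n \<Rightarrow> complex ^ 'n ^ 'n \<Rightarrow> complex ^ 'n ^ 'n" where
  "Phi_zzbar B C = scale_mat (1 / 4) (B ** matrix_inv (im_mat C) ** conj_transpose B)"

definition Phi_zz ::
  "complex ^ 'n ^ 'n \<Rightarrow> complex ^ 'n ^ 'n \<Rightarrow> complex ^ 'n ^ 'n \<Rightarrow> complex ^ 'n ^ 'n" where
  "Phi_zz A B C =
     - scale_mat (1 / 4) (B ** matrix_inv (im_mat C) ** transpose B) - scale_mat (1 / (2 * \<i>)) A"

text \<open>Under the standing assumptions \<open>Phi_zzbar B C\<close> is Hermitian, so the first pairing is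
  already real; \<open>Re\<close> only makes the weight a real-valued function.\<close>

definition Phi ::
  "complex ^ 'n ^ 'n \<Rightarrow> complex ^ 'n ^ 'n \<Rightarrow> complex ^ 'n ^ 'n \<Rightarrow> complex ^ 'n \<Rightarrow> real" where
  "Phi A B C z = Re (bilin z (Phi_zzbar B C *v cnj_vec z)) + Re (bilin z (Phi_zz A B C *v z))"


subsection \<open>Weighted spaces of entire functions\<close>

definition entire :: "(complex ^ 'n \<Rightarrow> complex) \<Rightarrow> bool" where
  "entire F \<longleftrightarrow>
     (\<forall>z. \<exists>F'. (F has_derivative F') (at z) \<and> (\<forall>c v. F' (c *s v) = c * F' v))"

definition partial_deriv :: "'n \<Rightarrow> (complex ^ 'n \<Rightarrow> complex) \<Rightarrow> complex ^ 'n \<Rightarrow> complex" where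
  "partial_deriv k F z = deriv (\<lambda>w. F (z + axis k w)) 0"

definition H_space :: "(complex ^ 'n \<Rightarrow> real) \<Rightarrow> (complex ^ 'n \<Rightarrow> complex) set" where
  "H_space \<phi> =
     {F. entire F \<and> integrable lborel (\<lambda>z. (cmod (F z))\<^sup>2 * exp (- 2 * \<phi> z))}"

definition H_inner ::
  "(complex ^ 'n \<Rightarrow> real) \<Rightarrow> (complex ^ 'n \<Rightarrow> complex) \<Rightarrow> (complex ^ 'n \<Rightarrow> complex) \<Rightarrow> complex" where
  "H_inner \<phi> F G =
     (LINT z|lborel. F z * cnj (G z) * complex_of_real (exp (- 2 * \<phi> z)))"


subsection \<open>First-order operators, adjoints and commutators\<close>

type_synonym 'n operator = "(complex ^ 'n \<Rightarrow> complex) \<Rightarrow> complex ^ 'n \<Rightarrow> complex"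

definition first_order_op :: "complex ^ 'n \<Rightarrow> complex ^ 'n \<Rightarrow> complex \<Rightarrow> ('n::finite) operator" where
  "first_order_op a b c F z =
     (\<Sum>k\<in>UNIV. a $ k * partial_deriv k F z) + (\<Sum>k\<in>UNIV. b $ k * z $ k) * F z + c * F z"

definition op_domain :: "(complex ^ 'n \<Rightarrow> real) \<Rightarrow> (complex ^ 'n \<Rightarrow> complex) set" where
  "op_domain \<phi> =
     {F \<in> H_space \<phi>. \<forall>k. (\<lambda>z. z $ k * F z) \<in> H_space \<phi> \<and> partial_deriv k F \<in> H_space \<phi>}"

definition adjoint_op :: "(complex ^ 'n \<Rightarrow> real) \<Rightarrow> ('n::finite) operator \<Rightarrow> 'n operator" where
  "adjoint_op \<phi> T =
     (THE S. (\<exists>a b c. S = first_order_op a b c) \<and>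
        (\<forall>F\<in>op_domain \<phi>. \<forall>G\<in>op_domain \<phi>. H_inner \<phi> (T F) G = H_inner \<phi> F (S G)))"

definition commutator :: "('n::finite) operator \<Rightarrow> 'n operator \<Rightarrow> 'n operator" where
  "commutator P P' F z = P (P' F) z - P' (P F) z"

text \<open>Equality with a scalar as operators on entire functions.\<close>

definition is_scalar_op :: "('n::finite) operator \<Rightarrow> complex \<Rightarrow> bool" where
  "is_scalar_op P c \<longleftrightarrow> (\<forall>F. entire F \<longrightarrow> (\<forall>z. P F z = c * F z))"

definition Lambda_op :: "complex ^ 'n ^ 'n \<Rightarrow> 'n \<Rightarrow> ('n::finite) operator" where
  "Lambda_op R i F z = partial_deriv i F z + (\<Sum>j\<in>UNIV. R $ i $ j * z $ j) * F z"

definition psi0 :: "complex ^ 'n ^ 'n \<Rightarrow> complex ^ 'n \<Rightarrow> complex" where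
  "psi0 Q z = exp (- bilin z (Q *v z))"


subsection \<open>The two conditions\<close>

text \<open>As for the weight, the first pairing is real when \<open>P\<close> is Hermitian.\<close>

definition condition1 ::
  "complex ^ 'n ^ 'n \<Rightarrow> complex ^ 'n ^ 'n \<Rightarrow> complex ^ 'n ^ 'n \<Rightarrow> bool" where
  "condition1 P S Q \<longleftrightarrow>
     (\<exists>\<delta>>0. \<forall>z. Re (bilin z (P *v cnj_vec z)) + Re (bilin z ((S + Q) *v z)) \<ge> \<delta> * (norm z)\<^sup>2)"

definition condition2 ::
  "(complex ^ 'n \<Rightarrow> real) \<Rightarrow> real \<Rightarrow> complex ^ 'n ^ 'n \<Rightarrow> complex ^ 'n ^ 'n \<Rightarrow> bool" where
  "condition2 \<phi> \<rho> Q R \<longleftrightarrow>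
     (\<forall>i z. Lambda_op R i (psi0 Q) z = 0) \<and>
     (\<forall>i j. is_scalar_op (commutator (Lambda_op R i) (Lambda_op R j)) 0) \<and>
     (\<forall>i j. is_scalar_op (commutator (Lambda_op R i) (adjoint_op \<phi> (Lambda_op R j)))
        (if i = j then 2 * (complex_of_real \<rho>)\<^sup>2 else 0))"

end

theory Submission
  imports Defs "HOL-Complex_Analysis.Cauchy_Integral_Formula" "HOL-Probability.Distributions"
begin

text \<open>
  Write \<open>P = Phi_zzbar B C\<close>, \<open>S = Phi_zz A B C\<close>. Integrating \<open>F * cnj G * exp (- 2 \<Phi>)\<close> by parts shows
  that \<open>\<partial> - 2 S z\<close> has adjoint \<open>2 cnj P z\<close>, so with \<open>M = R + 2 S\<close> the adjoints of the
  \<open>\<Lambda>\<^sub>i\<close> are \<open>N \<partial> + (2 cnj P - 2 N S) z\<close>, where \<open>N = (1/2) cnj M P\<inverse>\<close>. The annihilation of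
  \<open>exp (- \<langle>z, Q z\<rangle>)\<close> says \<open>R = 2 Q\<close>, which makes the \<open>\<Lambda>\<^sub>i\<close> commute, and the remaining relation
  becomes, for the symmetric matrix \<open>T = S + Q\<close>, the equation \<open>cnj T P\<inverse> T = cnj P - \<rho>\<^sup>2\<close>.
  Diagonalising \<open>P\<close> by \<open>U\<close>, this says that \<open>X = diag(1/\<mu>) U\<^sup>* T cnj U diag(1/\<lambda>)\<close> is
  unitary, while the symmetry of \<open>T\<close> is the intertwining relation for \<open>X\<close>. Condition 1 is then
  automatic, because \<open>|\<langle>z, T z\<rangle>| \<le> |diag \<mu> w| |diag \<lambda> w|\<close> for \<open>w = \<^sup>tU z\<close> and
  \<open>\<lambda>\<^sub>i\<^sup>2 - \<mu>\<^sub>i\<^sup>2 = \<rho>\<^sup>2\<close>.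
\<close>

subsection \<open>Complex matrices\<close>

lemma cnj_mat_nth [simp]: "cnj_mat M $ i $ j = cnj (M $ i $ j)"
  by (simp add: cnj_mat_def)

lemma scale_mat_nth [simp]: "scale_mat c M $ i $ j = c * M $ i $ j"
  by (simp add: scale_mat_def)

lemma diag_mat_nth: "diag_mat d $ i $ j = (if i = j then complex_of_real (d i) else 0)"
  by (simp add: diag_mat_def)

lemma cnj_vec_nth [simp]: "cnj_vec z $ i = cnj (z $ i)"
  by (simp add: cnj_vec_def)

lemma cnj_mat_mult: "cnj_mat (M ** N) = cnj_mat M ** cnj_mat N"
  by (simp add: vec_eq_iff matrix_matrix_mult_def)

lemma cnj_mat_cnj_mat [simp]: "cnj_mat (cnj_mat M) = M"
  by (simp add: vec_eq_iff)

lemma cnj_mat_mat [simp]: "cnj_mat (mat c) = mat (cnj c)"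
  by (simp add: vec_eq_iff mat_def)

lemma cnj_mat_transpose: "cnj_mat (transpose M) = transpose (cnj_mat M)"
  by (simp add: vec_eq_iff transpose_def)

lemma cnj_mat_diag [simp]: "cnj_mat (diag_mat d) = diag_mat d"
  by (simp add: vec_eq_iff diag_mat_nth)

lemma transpose_diag [simp]: "transpose (diag_mat d) = diag_mat d"
  by (auto simp add: vec_eq_iff transpose_def diag_mat_nth)

lemma diag_mult_diag: "diag_mat d ** diag_mat e = diag_mat (\<lambda>i. d i * e i)"
  by (simp add: vec_eq_iff matrix_matrix_mult_def diag_mat_nth if_distrib[of "\<lambda>x. x * _"]
      cong: if_cong)

lemma diag_mat_const: "diag_mat (\<lambda>i. c) = mat (complex_of_real c)"
  by (simp add: vec_eq_iff diag_mat_nth mat_def)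

lemma diag_mat_mult_vec: "diag_mat d *v z = (\<chi> i. complex_of_real (d i) * z $ i)"
  by (simp add: vec_eq_iff matrix_vector_mult_def diag_mat_nth if_distrib[of "\<lambda>x. x * _"]
      cong: if_cong)

lemma transpose_add: "transpose (M + N) = transpose M + transpose N"
  by (simp add: vec_eq_iff transpose_def)

lemma transpose_diff: "transpose (M - N) = transpose M - (transpose N :: complex ^ 'n ^ 'm)"
  by (simp add: vec_eq_iff transpose_def)

lemma matrix_diff_mult: "(M - N) ** K = M ** K - N ** (K :: complex ^ 'n ^ 'n)"
  by (simp add: vec_eq_iff matrix_matrix_mult_def left_diff_distrib sum_subtractf)

lemma mult_matrix_diff: "K ** (M - N) = K ** M - K ** (N :: complex ^ 'n ^ 'n)"
  by (simp add: vec_eq_iff matrix_matrix_mult_def right_diff_distrib sum_subtractf)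

lemma mat_mult_commute: "(M :: complex ^ 'n ^ 'n) ** mat c = mat c ** M"
  by (simp add: vec_eq_iff matrix_matrix_mult_def mat_def if_distrib[of "\<lambda>x. x * _"]
      if_distrib[of "\<lambda>x. _ * x"] mult.commute cong: if_cong)

lemma transpose_scale: "transpose (scale_mat c M) = scale_mat c (transpose M)"
  by (simp add: vec_eq_iff transpose_def)

lemma matrix_cancel_left:
  fixes A B C :: "complex ^ 'n ^ 'n"
  assumes "A ** B = mat 1"
  shows "A ** (B ** C) = C"
  using assms by (simp add: matrix_mul_assoc)

text \<open>Entrywise conjugation of the two unitarity relations. They are needed in this form
  because \<open>bilin\<close> involves no conjugation, so moving \<open>U\<close> across it
  produces \<open>transpose U\<close> and not \<open>conj_transpose U\<close>.\<close>

lemma unitary_mat_cnj: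
  assumes "unitary_mat U"
  shows "transpose U ** cnj_mat U = mat 1" "cnj_mat U ** transpose U = mat 1"
proof -
  have "cnj_mat (conj_transpose U ** U) = mat 1" "cnj_mat (U ** conj_transpose U) = mat 1"
    using assms by (simp_all add: unitary_mat_def)
  then show "transpose U ** cnj_mat U = mat 1" "cnj_mat U ** transpose U = mat 1"
    by (simp_all add: cnj_mat_mult conj_transpose_def cnj_mat_transpose)
qed

lemma bilin_mult_vec:
  fixes M :: "complex ^ 'n ^ 'm"
  shows "bilin x (M *v y) = bilin (x v* M) y"
proof -
  have "bilin x (M *v y) = (\<Sum>i\<in>UNIV. \<Sum>j\<in>UNIV. x $ i * (M $ i $ j * y $ j))"
    by (simp add: bilin_def matrix_vector_mult_def sum_distrib_left)
  also have "\<dots> = (\<Sum>j\<in>UNIV. \<Sum>i\<in>UNIV. x $ i * (M $ i $ j * y $ j))"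
    by (rule sum.swap)
  also have "\<dots> = bilin (x v* M) y"
    by (simp add: bilin_def vector_matrix_mult_def sum_distrib_left sum_distrib_right mult_ac)
  finally show ?thesis .
qed

lemma unitary_norm:
  assumes "unitary_mat U"
  shows "norm (U *v z) = norm z"
proof -
  have n2: "complex_of_real ((norm w)\<^sup>2) = bilin (cnj_vec w) w" for w :: "complex ^ 'n"
    by (simp add: norm_vec_def L2_set_def bilin_def sum_nonneg complex_norm_square
        mult.commute flip: of_real_power)
  have "cnj_vec (U *v z) = cnj_vec z v* conj_transpose U"
    by (simp add: vec_eq_iff matrix_vector_mult_def vector_matrix_mult_def conj_transpose_def
        transpose_def mult.commute)
  then have "bilin (cnj_vec (U *v z)) (U *v z) = bilin (cnj_vec z) ((conj_transpose U ** U) *v z)"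
    by (simp add: bilin_mult_vec[symmetric] matrix_vector_mul_assoc)
  then have "complex_of_real ((norm (U *v z))\<^sup>2) = complex_of_real ((norm z)\<^sup>2)"
    using assms by (simp add: n2 unitary_mat_def del: of_real_power)
  then have "(norm (U *v z))\<^sup>2 = (norm z)\<^sup>2"
    unfolding of_real_eq_iff .
  then show ?thesis by simp
qed

section \<open>The Riccati equation in an eigenbasis of \<open>P\<close>\<close>

lemma spectral_form:
  assumes U: "unitary_mat U"
    and D: "conj_transpose U ** P ** U = D"
  shows "P = U ** D ** conj_transpose U"
proof -
  have "U ** (conj_transpose U ** P ** U) ** conj_transpose U
      = (U ** conj_transpose U) ** P ** (U ** conj_transpose U)"
    by (simp add: matrix_mul_assoc)
  then show ?thesis using U D by (simp add: unitary_mat_def)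
qed

text \<open>Solve the factorisation for \<open>X\<close>. As \<open>T\<close> is symmetric,
  \<open>transpose X\<close> is the same product with the two inverse diagonal factors interchanged,
  so the inner factors of \<open>cnj_mat X ** transpose X\<close> assemble to \<open>V\<close>. The
  outer factors turn \<open>cnj_mat P - mat ((complex_of_real \<rho>)\<^sup>2)\<close> into the
  identity, since the squares of the \<open>\<mu> i\<close> are its eigenvalues.\<close>

lemma riccati_iff_unitary_factor:
  fixes P T U V :: "complex ^ 'n ^ 'n" and lam \<mu> :: "'n \<Rightarrow> real"
  assumes U: "unitary_mat U"
    and P: "P = U ** diag_mat (\<lambda>i. (lam i)\<^sup>2) ** conj_transpose U"
    and V: "V ** P = mat 1"
    and lam: "\<And>i. lam i > 0" and mu: "\<And>i. \<mu> i > 0"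
    and mu2: "\<And>i. (\<mu> i)\<^sup>2 = (lam i)\<^sup>2 - \<rho>\<^sup>2"
    and T: "transpose T = T"
  shows "(\<exists>X. unitary_mat X \<and>
            transpose X ** diag_mat (\<lambda>i. \<mu> i / lam i) = diag_mat (\<lambda>i. \<mu> i / lam i) ** X \<and>
            T = U ** diag_mat \<mu> ** X ** diag_mat lam ** transpose U)
         \<longleftrightarrow> cnj_mat T ** V ** T = cnj_mat P - mat ((complex_of_real \<rho>)\<^sup>2)"
    (is "?lhs \<longleftrightarrow> ?rhs")
proof -
  define iL where "iL = diag_mat (\<lambda>i. 1 / lam i)"
  define iM where "iM = diag_mat (\<lambda>i. 1 / \<mu> i)"
  define L where "L = diag_mat lam"
  define M where "M = diag_mat \<mu>"
  define K where "K = diag_mat (\<lambda>i. \<mu> i / lam i)"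
  define Uc where "Uc = cnj_mat U"
  define Ut where "Ut = transpose U"
  define Us where "Us = conj_transpose U"
  \<comment> \<open>Products are kept nested to the right by \<open>asc\<close>; \<open>c\<close>
    then cancels adjacent inverse pairs, with its premise supplied by \<open>u\<close> and
    \<open>d\<close>.\<close>
  note c = matrix_cancel_left
  have nz: "lam i \<noteq> 0" "\<mu> i \<noteq> 0" for i using lam[of i] mu[of i] by auto
  have u: "Us ** U = mat 1" "U ** Us = mat 1" "Ut ** Uc = mat 1" "Uc ** Ut = mat 1"
    using U unitary_mat_cnj[OF U] by (simp_all add: unitary_mat_def Us_def Ut_def Uc_def)
  have d: "iL ** L = mat 1" "L ** iL = mat 1" "iM ** M = mat 1" "M ** iM = mat 1"
    using nz by (simp_all add: iL_def iM_def L_def M_def diag_mult_diag diag_mat_const)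
  have kk: "iL ** M = K" "M ** iL = K"
    by (simp_all add: K_def iL_def M_def diag_mult_diag)
  have L2: "L ** L = diag_mat (\<lambda>i. (lam i)\<^sup>2)"
    by (simp add: L_def diag_mult_diag power2_eq_square)
  have M2: "M ** M = L ** L - mat ((complex_of_real \<rho>)\<^sup>2)"
  proof -
    have "M ** M = diag_mat (\<lambda>i. (\<mu> i)\<^sup>2)"
      by (simp add: M_def diag_mult_diag power2_eq_square)
    also have "\<dots> = L ** L - mat ((complex_of_real \<rho>)\<^sup>2)"
      by (simp add: L2 mu2 vec_eq_iff diag_mat_nth mat_def)
    finally show ?thesis .
  qed
  have t: "transpose U = Ut" "transpose Ut = U" "transpose Uc = Us" "transpose Us = Uc"
      "cnj_mat U = Uc" "cnj_mat Uc = U" "cnj_mat Us = Ut" "cnj_mat Ut = Us"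
      "cnj_mat L = L" "cnj_mat M = M" "cnj_mat iL = iL" "cnj_mat iM = iM"
      "transpose L = L" "transpose M = M" "transpose iL = iL" "transpose iM = iM"
      "transpose K = K"
    by (simp_all add: Ut_def Uc_def Us_def conj_transpose_def cnj_mat_transpose iL_def iM_def L_def M_def K_def)
  note asc = matrix_mul_assoc[symmetric]
  have P': "P = U ** (L ** (L ** Us))"
    by (simp add: P L2[symmetric] Us_def asc)
  have V': "V = U ** (iL ** (iL ** Us))"
  proof -
    have "P ** (U ** (iL ** (iL ** Us))) = mat 1"
      by (simp add: P' asc c u d)
    then have "V ** mat 1 = (V ** P) ** (U ** (iL ** (iL ** Us)))"
      by (simp add: asc)
    then show ?thesis using V by simp
  qed
  have cP: "cnj_mat P = Uc ** (L ** (L ** Ut))"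
    by (simp add: P' cnj_mat_mult t)
  have rhs: "cnj_mat P - mat ((complex_of_real \<rho>)\<^sup>2) = Uc ** (M ** (M ** Ut))"
  proof -
    have "Uc ** (M ** (M ** Ut)) = Uc ** ((M ** M) ** Ut)" by (simp add: asc)
    also have "\<dots> = Uc ** (L ** (L ** Ut)) - Uc ** (mat ((complex_of_real \<rho>)\<^sup>2) ** Ut)"
      unfolding M2 by (simp add: matrix_diff_mult mult_matrix_diff asc)
    also have "Uc ** (mat ((complex_of_real \<rho>)\<^sup>2) ** Ut) = mat ((complex_of_real \<rho>)\<^sup>2)"
      by (simp add: matrix_mul_assoc mat_mult_commute[of Uc])
         (simp add: asc u)
    finally show ?thesis by (simp add: cP)
  qed
  show ?thesis
  proof
    assume ?lhs
    then obtain X where "unitary_mat X" "T = U ** M ** X ** L ** Ut"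
      unfolding L_def[symmetric] M_def[symmetric] Ut_def[symmetric] by blast
    then have X: "unitary_mat X" "T = U ** (M ** (X ** (L ** Ut)))"
      by (simp_all add: asc)
    have cX: "cnj_mat X ** transpose X = mat 1" using unitary_mat_cnj[OF X(1)] by simp
    \<comment> \<open>Transposing the factorisation reverses its factors. With this form for the
      right-hand \<open>T\<close>, the diagonal factors around \<open>V\<close> cancel and
      \<open>cnj_mat X\<close> meets \<open>transpose X\<close>.\<close>
    have T1: "T = U ** (L ** (transpose X ** (M ** Ut)))"
      using arg_cong[OF X(2), of transpose] by (simp add: T matrix_transpose_mul t asc)
    have T2: "cnj_mat T = Uc ** (M ** (cnj_mat X ** (L ** Us)))"
      by (simp add: X(2) cnj_mat_mult t)
    have "cnj_mat T ** V ** T = Uc ** (M ** (M ** Ut))"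
      unfolding T2 by (simp add: T1 V' asc c u d cX)
    then show ?rhs by (simp add: rhs)
  next
    assume ?rhs
    then have e: "cnj_mat T ** (V ** T) = Uc ** (M ** (M ** Ut))" by (simp add: rhs asc)
    define X where "X = iM ** (Us ** (T ** (Uc ** iL)))"
    have TX: "T = U ** (M ** (X ** (L ** Ut)))"
      by (simp add: X_def asc c u d)
    have cX: "cnj_mat X = iM ** (Ut ** (cnj_mat T ** (U ** iL)))"
      by (simp add: X_def cnj_mat_mult t)
    have tX: "transpose X = iL ** (Us ** (T ** (Uc ** iM)))"
      by (simp add: X_def matrix_transpose_mul t T asc)
    have "cnj_mat X ** transpose X = iM ** (Ut ** ((cnj_mat T ** (V ** T)) ** (Uc ** iM)))"
      by (simp add: cX tX V' asc)
    also have "\<dots> = mat 1"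
      by (simp add: e asc c u d)
    finally have 1: "cnj_mat X ** transpose X = mat 1" .
    then have "cnj_mat (cnj_mat X ** transpose X) = mat 1" by simp
    then have 2: "X ** conj_transpose X = mat 1"
      by (simp add: cnj_mat_mult cnj_mat_transpose conj_transpose_def)
    then have "unitary_mat X"
      unfolding unitary_mat_def using matrix_left_right_inverse1[OF 2] by blast
    \<comment> \<open>Splitting \<open>K\<close> as \<open>M ** iL\<close> on the left and as
      \<open>iL ** M\<close> on the right cancels \<open>M\<close> against \<open>iM\<close>, and
      both sides become the same product.\<close>
    moreover have "transpose X ** K = K ** X"
    proof -
      have "transpose X ** K = iL ** (Us ** (T ** (Uc ** iL)))"
        by (subst kk(2)[symmetric]) (simp add: tX asc c d)
      also have "\<dots> = K ** X"
        by (subst kk(1)[symmetric]) (simp add: X_def asc c d)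
      finally show ?thesis .
    qed
    moreover have "T = U ** M ** X ** L ** Ut"
      by (subst TX) (simp add: asc)
    ultimately show ?lhs
      unfolding L_def[symmetric] M_def[symmetric] Ut_def[symmetric] K_def[symmetric]
      by (intro exI[of _ X] conjI)
  qed
qed

section \<open>Condition 1 from the unitary factor\<close>

lemma hermitian_form_spectral:
  fixes U :: "complex ^ 'n ^ 'n"
  assumes "P = U ** diag_mat (\<lambda>i. (lam i)\<^sup>2) ** conj_transpose U"
  shows "bilin z (P *v cnj_vec z)
    = complex_of_real ((norm (diag_mat lam *v (transpose U *v z)))\<^sup>2)"
proof -
  define w where "w = transpose U *v z"
  \<comment> \<open>The left factor \<open>U\<close> of \<open>P\<close> passes to \<open>z\<close>
    as its transpose, and the right factor yields the conjugate of the same vector; hence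
    \<open>transpose U *v z\<close> is the diagonalising variable.\<close>
  have cw: "cnj_vec w = conj_transpose U *v cnj_vec z"
    by (simp add: vec_eq_iff w_def matrix_vector_mult_def conj_transpose_def transpose_def)
  have "bilin z (P *v cnj_vec z) = bilin w (diag_mat (\<lambda>i. (lam i)\<^sup>2) *v cnj_vec w)"
  proof -
    have "bilin z (P *v cnj_vec z)
        = bilin z (U *v (diag_mat (\<lambda>i. (lam i)\<^sup>2) *v (conj_transpose U *v cnj_vec z)))"
      by (simp add: assms matrix_vector_mul_assoc matrix_mul_assoc)
    then show ?thesis by (simp add: bilin_mult_vec[of z U] w_def cw[symmetric])
  qed
  also have "\<dots> = complex_of_real ((norm (diag_mat lam *v w))\<^sup>2)"
  proof -
    have e: "w $ j * (c * cnj (w $ j)) = c * (complex_of_real (cmod (w $ j)))\<^sup>2" for c j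
      using complex_norm_square[of "w $ j"] by (simp add: mult.left_commute[of "w $ j"])
    show ?thesis
      by (simp add: norm_vec_def L2_set_def bilin_def sum_nonneg diag_mat_mult_vec norm_mult
          power_mult_distrib e)
  qed
  finally show ?thesis by (simp add: w_def)
qed

text \<open>In the variable \<open>w\<close> the Hermitian form is the squared norm of
  \<open>diag_mat lam *v w\<close>, while the other form pairs \<open>diag_mat \<mu> *v w\<close>
  with an isometric image of \<open>diag_mat lam *v w\<close>. Cauchy-Schwarz bounds the second by
  the product of the two norms, and the norm with \<open>\<mu>\<close> is the smaller one.\<close>

lemma condition1_of_unitary_factor:
  fixes P S Q U X :: "complex ^ 'n ^ 'n"
  assumes U: "unitary_mat U" and X: "unitary_mat X"
    and P: "P = U ** diag_mat (\<lambda>i. (lam i)\<^sup>2) ** conj_transpose U"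
    and T: "S + Q = U ** diag_mat \<mu> ** X ** diag_mat lam ** transpose U"
    and mu2: "\<And>i. (\<mu> i)\<^sup>2 = (lam i)\<^sup>2 - \<rho>\<^sup>2" and "\<rho> > 0"
  shows "condition1 P S Q"
  unfolding condition1_def
proof (intro exI[of _ "\<rho>\<^sup>2 / 2"] conjI allI)
  show "0 < \<rho>\<^sup>2 / 2" using \<open>\<rho> > 0\<close> by simp
  fix z :: "complex ^ 'n"
  define w where "w = transpose U *v z"
  have "unitary_mat (transpose U)"
    using unitary_mat_cnj[OF U] by (simp add: unitary_mat_def conj_transpose_def cnj_mat_transpose)
  then have nw: "norm w = norm z" using unitary_norm[of "transpose U" z] by (simp add: w_def)
  let ?l = "norm (diag_mat lam *v w)" and ?m = "norm (diag_mat \<mu> *v w)"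
  have sq: "(norm (diag_mat d *v w))\<^sup>2 = (\<Sum>i\<in>UNIV. (d i)\<^sup>2 * (cmod (w $ i))\<^sup>2)" for d
    by (simp add: norm_vec_def L2_set_def sum_nonneg diag_mat_mult_vec norm_mult power_mult_distrib)
  have ml: "?m\<^sup>2 = ?l\<^sup>2 - \<rho>\<^sup>2 * (norm w)\<^sup>2"
    unfolding sq mu2
    by (simp add: norm_vec_def L2_set_def sum_nonneg sum_subtractf left_diff_distrib sum_distrib_left)
  have c: "cmod (bilin z ((S + Q) *v z)) \<le> ?m * ?l"
  proof -
    have "bilin z ((S + Q) *v z) = bilin (diag_mat \<mu> *v w) (X *v (diag_mat lam *v w))"
    proof -
      have "bilin z ((S + Q) *v z)
          = bilin z (U *v (diag_mat \<mu> *v (X *v (diag_mat lam *v w))))"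
        by (simp add: T w_def matrix_vector_mul_assoc matrix_mul_assoc del: transpose_matrix_vector)
      also have "\<dots> = bilin (w v* diag_mat \<mu>) (X *v (diag_mat lam *v w))"
        by (simp add: bilin_mult_vec[of z U] bilin_mult_vec[of _ "diag_mat \<mu>"] w_def)
      also have "w v* diag_mat \<mu> = diag_mat \<mu> *v w"
        by (metis transpose_diag transpose_matrix_vector)
      finally show ?thesis .
    qed
    also have "cmod \<dots> \<le> norm (diag_mat \<mu> *v w) * norm (X *v (diag_mat lam *v w))"
    proof -
      have "cmod (bilin x y) \<le> norm x * norm y" for x y :: "complex ^ 'n"
      proof -
        have "cmod (bilin x y) \<le> (\<Sum>j\<in>UNIV. cmod (x $ j) * cmod (y $ j))"
          unfolding bilin_def by (rule order_trans[OF norm_sum]) (simp add: norm_mult)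
        also have "\<dots> \<le> norm x * norm y"
          using L2_set_mult_ineq[of "\<lambda>j. cmod (x $ j)" "\<lambda>j. cmod (y $ j)" UNIV]
          by (simp add: norm_vec_def)
        finally show ?thesis .
      qed
      then show ?thesis .
    qed
    finally show ?thesis using X by (simp add: unitary_norm)
  qed
  \<comment> \<open>Replacing the product by the mean of the squares leaves half of the gap
    \<open>?l\<^sup>2 - ?m\<^sup>2\<close>, which is where the constant
    \<open>\<rho>\<^sup>2 / 2\<close> comes from.\<close>
  have am: "?m * ?l \<le> (?m\<^sup>2 + ?l\<^sup>2) / 2"
    using sum_squares_bound[of ?m ?l] by simp
  have r: "- Re (bilin z ((S + Q) *v z)) \<le> cmod (bilin z ((S + Q) *v z))"
    using abs_Re_le_cmod[of "bilin z ((S + Q) *v z)"] by linarith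
  have p: "Re (bilin z (P *v cnj_vec z)) = ?l\<^sup>2"
    using hermitian_form_spectral[OF P, of z] by (simp add: w_def)
  have "?l\<^sup>2 - \<rho>\<^sup>2 / 2 * (norm z)\<^sup>2 = (?m\<^sup>2 + ?l\<^sup>2) / 2"
    using ml unfolding nw by (simp add: field_simps)
  then show "\<rho>\<^sup>2 / 2 * (norm z)\<^sup>2
      \<le> Re (bilin z (P *v cnj_vec z)) + Re (bilin z ((S + Q) *v z))"
    using c am r unfolding p by linarith
qed

subsection \<open>Entire functions and commutators\<close>

lemma axis_eq_smult: "axis k w = w *s (axis k 1 :: complex ^ 'n)"
  by (simp add: vec_eq_iff axis_def)

lemma sum_axis_mult: "(\<Sum>l\<in>UNIV. (axis k w :: complex ^ 'n) $ l * D l) = w * D k"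
  by (simp add: axis_def if_distrib[of "\<lambda>x. x * _"] cong: if_cong)

lemma axis_zero [simp]: "(axis k 0 :: complex ^ 'n) = 0"
  by (simp add: vec_eq_iff axis_def)

lemma bounded_linear_axis: "bounded_linear (axis k :: complex \<Rightarrow> complex ^ 'n)"
  by (rule linear_conv_bounded_linear[THEN iffD1], rule linearI)
     (simp_all add: vec_eq_iff axis_def)

text \<open>The derivative is additive and commutes with complex scalars, so expanding its argument
  in the standard basis expresses it through its values on the axes; these are the partial
  derivatives.\<close>

lemma entire_has_derivative:
  fixes F :: "complex ^ 'n \<Rightarrow> complex"
  assumes "entire F"
  shows "(F has_derivative (\<lambda>v. \<Sum>k\<in>UNIV. v $ k * partial_deriv k F z)) (at z)"
proof -
  obtain F' where F': "(F has_derivative F') (at z)" and lin: "\<And>c v. F' (c *s v) = c * F' v"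
    using assms unfolding entire_def by blast
  have pd: "partial_deriv k F z = F' (axis k 1)" for k
  proof -
    have "((\<lambda>w. F (z + axis k w)) has_derivative (\<lambda>w. F' (axis k w))) (at 0)"
      by (rule has_derivative_compose[where g=F and g'=F'])
         (use F' in \<open>auto intro!: derivative_eq_intros bounded_linear_imp_has_derivative bounded_linear_axis\<close>)
    moreover have "(\<lambda>w. F' (axis k w)) = (*) (F' (axis k 1))"
    proof
      fix w show "F' (axis k w) = F' (axis k 1) * w"
        unfolding axis_eq_smult[of k w] lin by (rule mult.commute)
    qed
    ultimately show ?thesis
      unfolding partial_deriv_def by (intro DERIV_imp_deriv) (simp add: has_field_derivative_def)
  qed
  have "F' v = (\<Sum>k\<in>UNIV. v $ k * partial_deriv k F z)" for v
  proof -
    have "F' v = F' (\<Sum>k\<in>UNIV. v $ k *s axis k 1)"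
      by (simp add: basis_expansion)
    also have "\<dots> = (\<Sum>k\<in>UNIV. F' (v $ k *s axis k 1))"
      using linear_sum[OF has_derivative_linear[OF F']] .
    finally show ?thesis by (simp add: lin pd)
  qed
  then have "F' = (\<lambda>v. \<Sum>k\<in>UNIV. v $ k * partial_deriv k F z)" ..
  then show ?thesis using F' by simp
qed

lemma entire_iff:
  fixes F :: "complex ^ 'n \<Rightarrow> complex"
  shows "entire F \<longleftrightarrow>
    (\<forall>z. (F has_derivative (\<lambda>v. \<Sum>k\<in>UNIV. v $ k * partial_deriv k F z)) (at z))"
proof
  assume "\<forall>z. (F has_derivative (\<lambda>v. \<Sum>k\<in>UNIV. v $ k * partial_deriv k F z)) (at z)"
  then show "entire F"
    unfolding entire_def
  proof (intro allI, elim allE, intro exI conjI allI)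
    show "(\<Sum>k\<in>UNIV. (c *s v) $ k * partial_deriv k F z)
        = c * (\<Sum>k\<in>UNIV. v $ k * partial_deriv k F z)" for c v z
      by (simp add: sum_distrib_left mult_ac)
  qed assumption
qed (simp add: entire_has_derivative)

lemma partial_deriv_eqI:
  fixes F :: "complex ^ 'n \<Rightarrow> complex"
  assumes "(F has_derivative (\<lambda>v. \<Sum>k\<in>UNIV. v $ k * D k)) (at z)"
  shows "partial_deriv k F z = D k"
proof -
  have "((\<lambda>w. F (z + axis k w)) has_derivative (\<lambda>w. \<Sum>l\<in>UNIV. axis k w $ l * D l)) (at 0)"
    by (rule has_derivative_compose[where g=F])
       (use assms in \<open>auto intro!: derivative_eq_intros bounded_linear_imp_has_derivative bounded_linear_axis\<close>)
  moreover have "(\<lambda>w. \<Sum>l\<in>UNIV. axis k w $ l * D l) = (*) (D k)"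
    by (rule ext) (unfold sum_axis_mult, rule mult.commute)
  ultimately show ?thesis
    unfolding partial_deriv_def by (intro DERIV_imp_deriv) (simp add: has_field_derivative_def)
qed

lemma entireI:
  fixes F :: "complex ^ 'n \<Rightarrow> complex"
  assumes "\<And>z. (F has_derivative (\<lambda>v. \<Sum>k\<in>UNIV. v $ k * D k z)) (at z)"
  shows "entire F" and "partial_deriv k F z = D k z"
proof -
  show "partial_deriv k F z = D k z" for k z
    by (rule partial_deriv_eqI) (rule assms)
  then show "entire F" using assms by (simp add: entire_iff)
qed

lemma entire_line_deriv:
  fixes F :: "complex ^ 'n \<Rightarrow> complex"
  assumes "entire F"
  shows "((\<lambda>w. F (z + axis k w)) has_field_derivative partial_deriv k F (z + axis k w)) (at w)"
proof -
  let ?D = "\<lambda>l. partial_deriv l F (z + axis k w)"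
  have "((\<lambda>w. F (z + axis k w)) has_derivative (\<lambda>u. \<Sum>l\<in>UNIV. axis k u $ l * ?D l)) (at w)"
    by (rule has_derivative_compose[where g=F])
       (use entire_has_derivative[OF assms] in \<open>auto
            intro!: derivative_eq_intros bounded_linear_imp_has_derivative bounded_linear_axis\<close>)
  moreover have "(\<lambda>u. \<Sum>l\<in>UNIV. axis k u $ l * ?D l) = (*) (?D k)"
    by (rule ext) (unfold sum_axis_mult, rule mult.commute)
  ultimately show ?thesis
    unfolding has_field_derivative_def by simp
qed

lemma entire_continuous:
  fixes F :: "complex ^ 'n \<Rightarrow> complex"
  assumes "entire F" shows "continuous_on A F"
  by (intro continuous_at_imp_continuous_on ballI)
     (rule has_derivative_continuous[OF entire_has_derivative[OF assms]])

lemma entire_const: "entire (\<lambda>z :: complex ^ 'n. c)"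
  unfolding entire_def by (intro allI exI[of _ "\<lambda>_. 0"]) simp

text \<open>Cauchy's estimate for the second derivative makes the difference quotients in the second
  variable converge locally uniformly in the first.\<close>

lemma deriv_second_variable:
  fixes f :: "complex \<Rightarrow> complex \<Rightarrow> complex"
  assumes cont: "continuous_on UNIV (\<lambda>p. f (fst p) (snd p))"
    and hol2: "\<And>w. f w holomorphic_on UNIV"
    and hol1: "\<And>s. (\<lambda>w. f w s) holomorphic_on UNIV"
  obtains d where "((\<lambda>w. deriv (f w) 0) has_field_derivative d) (at 0)"
    and "(\<lambda>n. of_nat (Suc n) * (deriv (\<lambda>w. f w (1 / of_nat (Suc n))) 0 - deriv (\<lambda>w. f w 0) 0))
          \<longlonglongrightarrow> d"
proof -
  define q where "q = (\<lambda>n w. of_nat (Suc n) * (f w (1 / of_nat (Suc n)) - f w 0))"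
  define q' where "q' = (\<lambda>n w. of_nat (Suc n) *
     (deriv (\<lambda>w. f w (1 / of_nat (Suc n))) w - deriv (\<lambda>w. f w 0) w))"
  \<comment> \<open>A locally uniform limit of holomorphic functions may be differentiated termwise.
    Applied to the difference quotients \<open>q\<close>, this gives differentiability of the limit
    in the first variable and, at the same time, the formula for its derivative.\<close>
  have "\<exists>g'. \<forall>x\<in>UNIV. ((\<lambda>w. deriv (f w) 0) has_field_derivative g' x) (at x)
      \<and> (\<lambda>n. q' n x) \<longlonglongrightarrow> g' x"
  proof (rule has_complex_derivative_uniform_sequence[where f=q])
    show "(q n has_field_derivative q' n x) (at x)" for n x
      unfolding q_def q'_def
      by (intro DERIV_cmult DERIV_diff holomorphic_derivI[OF hol1]) auto
    fix x :: complex
    have "compact ((\<lambda>p. f (fst p) (snd p)) ` (cball x 1 \<times> cball 0 1))"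
      by (intro compact_continuous_image compact_Times compact_cball
          continuous_on_subset[OF cont]) auto
    then obtain M where M: "\<And>w s. w \<in> cball x 1 \<Longrightarrow> s \<in> cball 0 1 \<Longrightarrow> cmod (f w s) \<le> M"
      using compact_imp_bounded[THEN bounded_pos[THEN iffD1]] by fastforce
    \<comment> \<open>Cauchy's bound for the second derivative on discs of radius 1/2. Centred in
      the disc of radius 1/2, they stay inside the unit disc, where \<open>f\<close> is bounded by
      \<open>M\<close>; the bound \<open>M + 1\<close> gives the strict inequality that membership
      in an open ball requires.\<close>
    define B where "B = fact 2 * (M + 1) / (1/2)^2"
    \<comment> \<open>The restriction \<open>n \<ge> 1\<close> keeps the step
      \<open>1 / of_nat (Suc n)\<close> in the disc of radius 1/2 on which the second derivative is
      controlled.\<close>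
    have est: "cmod (q n w - deriv (f w) 0) \<le> B / real (Suc n)"
      if w: "w \<in> cball x 1" and n: "n \<ge> 1" for n w
    proof -
      define h :: complex where "h = 1 / of_nat (Suc n)"
      have h: "cmod h = 1 / real (Suc n)" "h \<noteq> 0" by (simp_all add: h_def norm_divide del: of_nat_Suc)
      have h2: "h \<in> cball 0 (1/2)" using n by (simp add: h field_simps)
      have "cmod ((deriv ^^ 0) (f w) h - (\<Sum>i\<le>1. (deriv ^^ i) (f w) 0 * (h - 0) ^ i / fact i))
          \<le> B * cmod (h - 0) ^ Suc 1 / fact 1"
      proof (rule complex_Taylor[where S="cball 0 (1/2)"])
        show "((deriv ^^ i) (f w) has_field_derivative (deriv ^^ Suc i) (f w) s)
            (at s within cball 0 (1 / 2))" for i s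
          by (rule has_field_derivative_at_within,
              rule has_field_derivative_higher_deriv[OF hol2]) auto
        show "cmod ((deriv ^^ Suc 1) (f w) s) \<le> B" if s: "s \<in> cball 0 (1 / 2)" for s
        proof -
          have "cmod ((deriv ^^ 2) (f w) s) \<le> B"
            unfolding B_def
          proof (rule Cauchy_higher_deriv_bound)
            show "f w holomorphic_on ball s (1/2)"
              by (rule holomorphic_on_subset[OF hol2]) simp
            show "continuous_on (cball s (1/2)) (f w)"
              by (rule holomorphic_on_imp_continuous_on[OF holomorphic_on_subset[OF hol2]]) simp
            fix u assume "u \<in> ball s (1/2)"
            then have "dist 0 u \<le> dist 0 s + dist s u" "dist s u < 1/2" "dist 0 s \<le> 1/2"
              using dist_triangle[of 0 u s] s by (auto simp: dist_commute)
            then have "u \<in> cball 0 1" by simp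
            then show "f w u \<in> ball 0 (M + 1)" using M[OF w] by force
          qed auto
          then show ?thesis by (simp add: numeral_2_eq_2)
        qed
      qed (use h2 in auto)
      then have "cmod (f w h - f w 0 - deriv (f w) 0 * h) \<le> B * (cmod h)\<^sup>2"
        by (simp add: power2_eq_square algebra_simps)
      moreover have "f w h - f w 0 - deriv (f w) 0 * h = h * (q n w - deriv (f w) 0)"
        using h(2) by (simp add: q_def h_def field_simps)
      ultimately have "cmod h * cmod (q n w - deriv (f w) 0) \<le> cmod h * (B * cmod h)"
        by (simp add: norm_mult power2_eq_square mult_ac)
      then have "cmod (q n w - deriv (f w) 0) \<le> B * cmod h"
        using h(2) by (simp add: mult_le_cancel_left)
      then show ?thesis by (simp add: h)
    qed
    have "uniform_limit (cball x 1) q (\<lambda>w. deriv (f w) 0) sequentially"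
    proof (rule uniform_limitI)
      fix e :: real assume "e > 0"
      have "(\<lambda>n. B / real (Suc n)) \<longlonglongrightarrow> 0"
        by (rule LIMSEQ_Suc[OF lim_const_over_n])
      then have "\<forall>\<^sub>F n in sequentially. B / real (Suc n) < e"
        using \<open>e > 0\<close> by (rule order_tendstoD)
      moreover have "\<forall>\<^sub>F n in sequentially. n \<ge> 1"
        by (rule eventually_ge_at_top)
      ultimately show "\<forall>\<^sub>F n in sequentially. \<forall>w\<in>cball x 1. dist (q n w) (deriv (f w) 0) < e"
        by eventually_elim (use est in \<open>force simp: dist_norm\<close>)
    qed
    then show "\<exists>d>0. cball x d \<subseteq> UNIV \<and> uniform_limit (cball x d) q (\<lambda>w. deriv (f w) 0) sequentially"
      by (intro exI[of _ 1]) auto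
  qed auto
  then show ?thesis using that unfolding q'_def by blast
qed

text \<open>One mixed derivative is known as the limit of difference quotients, in the second
  variable, of the first-variable derivative. With the variables exchanged, that function is itself
  differentiable at 0, so the same sequence also converges to the other mixed derivative, and
  uniqueness of limits identifies the two.\<close>

lemma mixed_deriv:
  fixes f :: "complex \<Rightarrow> complex \<Rightarrow> complex"
  assumes cont: "continuous_on UNIV (\<lambda>p. f (fst p) (snd p))"
    and hol2: "\<And>w. f w holomorphic_on UNIV"
    and hol1: "\<And>s. (\<lambda>w. f w s) holomorphic_on UNIV"
  obtains d where "((\<lambda>w. deriv (f w) 0) has_field_derivative d) (at 0)"
    and "((\<lambda>s. deriv (\<lambda>w. f w s) 0) has_field_derivative d) (at 0)"
proof -
  obtain d where d: "((\<lambda>w. deriv (f w) 0) has_field_derivative d) (at 0)"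
    and l: "(\<lambda>n. of_nat (Suc n) * (deriv (\<lambda>w. f w (1 / of_nat (Suc n))) 0 - deriv (\<lambda>w. f w 0) 0))
          \<longlonglongrightarrow> d"
    using deriv_second_variable[OF assms] by blast
  have "continuous_on UNIV (\<lambda>p. f (snd p) (fst p))"
    using continuous_on_compose[OF continuous_on_swap[of UNIV], of "\<lambda>p. f (fst p) (snd p)"]
      continuous_on_subset[OF cont] by (simp add: o_def)
  then obtain d' where d': "((\<lambda>s. deriv (\<lambda>w. f w s) 0) has_field_derivative d') (at 0)"
    using deriv_second_variable[of "\<lambda>s w. f w s", OF _ hol1 hol2] by blast
  have "filterlim (\<lambda>n. 1 / of_nat (Suc n) :: complex) (at 0) sequentially"
    unfolding filterlim_at
    using LIMSEQ_Suc[OF lim_const_over_n[of "1::complex"]] by (simp del: of_nat_Suc)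
  from filterlim_compose[OF d'[unfolded has_field_derivative_iff] this]
  have "(\<lambda>n. of_nat (Suc n) * (deriv (\<lambda>w. f w (1 / of_nat (Suc n))) 0 - deriv (\<lambda>w. f w 0) 0))
          \<longlonglongrightarrow> d'"
    by (simp add: mult.commute del: of_nat_Suc)
  then have "d = d'" using l LIMSEQ_unique by blast
  then show ?thesis using that d d' by blast
qed

text \<open>The definition of \<open>entire\<close> only provides first derivatives. Second partial
  derivatives are obtained on the slice through \<open>z\<close> in the directions \<open>i\<close>
  and \<open>k\<close>, where \<open>mixed_deriv\<close> applies; \<open>i = k\<close> is
  included.\<close>

lemma entire_mixed_partial:
  fixes F :: "complex ^ 'n \<Rightarrow> complex"
  assumes F: "entire F"
  shows "((\<lambda>w. partial_deriv k F (z + axis i w)) has_field_derivative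
            partial_deriv i (partial_deriv k F) z) (at 0)"
    and "partial_deriv i (partial_deriv k F) z = partial_deriv k (partial_deriv i F) z"
proof -
  define f where "f = (\<lambda>w s. F (z + axis i w + axis k s))"
  have f': "f = (\<lambda>w s. F (z + axis k s + axis i w))" by (simp add: f_def add_ac)
  have c: "continuous_on UNIV (\<lambda>p. f (fst p) (snd p))"
    unfolding f_def
    by (intro continuous_on_compose2[OF entire_continuous[OF F, of UNIV]] continuous_intros
        bounded_linear.continuous_on[OF bounded_linear_axis]) auto
  have h2: "f w holomorphic_on UNIV" for w
    unfolding f_def holomorphic_on_def field_differentiable_def using entire_line_deriv[OF F] by blast
  have h1: "(\<lambda>w. f w s) holomorphic_on UNIV" for s
    unfolding f' holomorphic_on_def field_differentiable_def using entire_line_deriv[OF F] by blast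
  obtain d where d: "((\<lambda>w. deriv (f w) 0) has_field_derivative d) (at 0)"
    "((\<lambda>s. deriv (\<lambda>w. f w s) 0) has_field_derivative d) (at 0)"
    using mixed_deriv[OF c h2 h1] by blast
  have e: "deriv (f w) 0 = partial_deriv k F (z + axis i w)" for w
    by (simp add: f_def partial_deriv_def)
  have e': "deriv (\<lambda>w. f w s) 0 = partial_deriv i F (z + axis k s)" for s
    by (simp add: f' partial_deriv_def)
  have d1: "partial_deriv i (partial_deriv k F) z = d"
    unfolding partial_deriv_def[of i] using d(1) unfolding e by (rule DERIV_imp_deriv)
  have d2: "partial_deriv k (partial_deriv i F) z = d"
    unfolding partial_deriv_def[of k "partial_deriv i F"] using d(2) unfolding e' by (rule DERIV_imp_deriv)
  show "((\<lambda>w. partial_deriv k F (z + axis i w)) has_field_derivative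
            partial_deriv i (partial_deriv k F) z) (at 0)"
    using d(1) unfolding e d1 .
  show "partial_deriv i (partial_deriv k F) z = partial_deriv k (partial_deriv i F) z"
    using d1 d2 by simp
qed

section \<open>Commutators of first-order operators\<close>

lemma partial_deriv_first_order_op:
  fixes F :: "complex ^ 'n \<Rightarrow> complex"
  assumes F: "entire F"
  shows "partial_deriv i (first_order_op a b c F) z =
    (\<Sum>k\<in>UNIV. a $ k * partial_deriv i (partial_deriv k F) z) + b $ i * F z
    + ((\<Sum>k\<in>UNIV. b $ k * z $ k) + c) * partial_deriv i F z"
proof -
  have ax: "((\<lambda>w. axis i w $ k) has_field_derivative (if k = i then 1 else 0)) (at 0)" for k
    by (cases "k = i") (auto simp: axis_def)
  have "((\<lambda>w. first_order_op a b c F (z + axis i w)) has_field_derivative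
     (\<Sum>k\<in>UNIV. a $ k * partial_deriv i (partial_deriv k F) z) +
     ((\<Sum>k\<in>UNIV. b $ k * (if k = i then 1 else 0)) * F (z + axis i 0) +
       partial_deriv i F (z + axis i 0) * (\<Sum>k\<in>UNIV. b $ k * (z + axis i 0) $ k))
      + c * partial_deriv i F (z + axis i 0)) (at 0)"
    unfolding first_order_op_def
    by (intro DERIV_add DERIV_sum DERIV_cmult DERIV_mult entire_mixed_partial[OF F]
        entire_line_deriv[OF F])
       (auto intro!: derivative_eq_intros ax)
  from DERIV_imp_deriv[OF this]
  have "partial_deriv i (first_order_op a b c F) z =
     (\<Sum>k\<in>UNIV. a $ k * partial_deriv i (partial_deriv k F) z) +
     ((\<Sum>k\<in>UNIV. b $ k * (if k = i then 1 else 0)) * F z +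
       partial_deriv i F z * (\<Sum>k\<in>UNIV. b $ k * z $ k)) + c * partial_deriv i F z"
    by (simp add: partial_deriv_def[of i "first_order_op a b c F"])
  then show ?thesis by (simp add: algebra_simps if_distrib[of "\<lambda>x. _ * x"] cong: if_cong)
qed

text \<open>All terms of the composition are symmetric in the two operators, the second-order ones
  by equality of mixed partials, except those in which a derivative falls on the linear coefficient
  of the other operator.\<close>

lemma commutator_first_order_op:
  fixes F :: "complex ^ 'n \<Rightarrow> complex"
  assumes F: "entire F"
  shows "commutator (first_order_op a b c) (first_order_op a' b' c') F z =
    ((\<Sum>k\<in>UNIV. a $ k * b' $ k) - (\<Sum>k\<in>UNIV. a' $ k * b $ k)) * F z"
proof -
  define d where "d a = (\<Sum>k\<in>UNIV. a $ k * partial_deriv k F z)" for a :: "complex ^ 'n"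
  define m where "m b = (\<Sum>k\<in>UNIV. b $ k * z $ k)" for b :: "complex ^ 'n"
  define s where "s a b = (\<Sum>k\<in>UNIV. a $ k * b $ k)" for a b :: "complex ^ 'n"
  define H where "H a a' = (\<Sum>i\<in>UNIV. \<Sum>k\<in>UNIV. a $ i * a' $ k * partial_deriv i (partial_deriv k F) z)"
    for a a' :: "complex ^ 'n"
  have sym: "H a a' = H a' a" for a a'
    unfolding H_def by (subst sum.swap)
      (simp add: entire_mixed_partial(2)[OF F, of _ _ z] mult_ac cong: sum.cong)
  have f: "first_order_op a b c F z = d a + m b * F z + c * F z" for a b c
    by (simp add: first_order_op_def d_def m_def)
  have "first_order_op a b c (first_order_op a' b' c' F) z
      = H a a' + s a b' * F z + (m b' + c') * d a + (m b + c) * (d a' + m b' * F z + c' * F z)"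
    for a b c a' b' c'
  proof -
    have "(\<Sum>i\<in>UNIV. a $ i * ((\<Sum>k\<in>UNIV. a' $ k * partial_deriv i (partial_deriv k F) z)
            + b' $ i * F z + (m b' + c') * partial_deriv i F z))
        = H a a' + s a b' * F z + (m b' + c') * d a"
      by (simp add: H_def s_def d_def distrib_left sum.distrib sum_distrib_left sum_distrib_right mult_ac)
    then show ?thesis
      unfolding first_order_op_def[of a b c "first_order_op a' b' c' F"]
        partial_deriv_first_order_op[OF F] f m_def[symmetric]
      by (simp add: distrib_right)
  qed
  then show ?thesis
    unfolding commutator_def s_def[symmetric]
    by (simp add: sym[of a' a] algebra_simps)
qed

text \<open>The commutator multiplies by a constant, and the entire function 1 detects which
  one.\<close>

lemma is_scalar_commutator_first_order_op:
  fixes a b a' b' :: "complex ^ 'n"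
  shows "is_scalar_op (commutator (first_order_op a b c) (first_order_op a' b' c')) r \<longleftrightarrow>
    (\<Sum>k\<in>UNIV. a $ k * b' $ k) - (\<Sum>k\<in>UNIV. a' $ k * b $ k) = r"
  using entire_const[of 1]
  by (auto simp: is_scalar_op_def commutator_first_order_op)

lemma Lambda_op_eq: "Lambda_op R i = first_order_op (axis i 1) (R $ i) 0"
  by (simp add: fun_eq_iff Lambda_op_def first_order_op_def sum_axis_mult)

subsection \<open>Gaussian test functions\<close>

text \<open>An inductive closure, so that differentiation and growth bounds follow by induction
  without a choice of coefficients.\<close>

inductive polynomial_fn :: "(complex ^ 'n \<Rightarrow> complex) \<Rightarrow> bool" where
  const: "polynomial_fn (\<lambda>z. c)"
| coord: "polynomial_fn (\<lambda>z. z $ k)"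
| add: "polynomial_fn p \<Longrightarrow> polynomial_fn q \<Longrightarrow> polynomial_fn (\<lambda>z. p z + q z)"
| mult: "polynomial_fn p \<Longrightarrow> polynomial_fn q \<Longrightarrow> polynomial_fn (\<lambda>z. p z * q z)"

lemma polynomial_fn_sum:
  "(\<And>i. i \<in> I \<Longrightarrow> polynomial_fn (p i)) \<Longrightarrow> polynomial_fn (\<lambda>z. \<Sum>i\<in>I. p i z)"
  by (induction I rule: infinite_finite_induct) (auto intro: polynomial_fn.intros)

lemma polynomial_fn_bilin: "polynomial_fn (\<lambda>z. bilin z (S *v z))"
  unfolding bilin_def matrix_vector_mult_def
  by (simp, intro polynomial_fn_sum polynomial_fn.intros)

lemma polynomial_fn_derivative:
  assumes "polynomial_fn p"
  obtains D where "\<And>z. (p has_derivative (\<lambda>v. \<Sum>k\<in>UNIV. v $ k * D k z)) (at z)"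
    and "\<And>k. polynomial_fn (D k)"
proof -
  have "\<exists>D. (\<forall>z. (p has_derivative (\<lambda>v. \<Sum>k\<in>UNIV. v $ k * D k z)) (at z)) \<and>
      (\<forall>k. polynomial_fn (D k))"
    using assms
  proof induction
    case (const c)
    show ?case by (rule exI[of _ "\<lambda>_ _. 0"]) (auto intro: polynomial_fn.intros)
  next
    case (coord l)
    have "((\<lambda>z. z $ l) has_derivative (\<lambda>v. \<Sum>k\<in>UNIV. v $ k * (if k = l then 1 else 0))) (at z)"
      for z :: "complex ^ 'a"
      by (simp add: if_distrib[of "\<lambda>x. _ * x"] bounded_linear_imp_has_derivative
          bounded_linear_vec_nth cong: if_cong)
    then show ?case
      by (intro exI[of _ "\<lambda>k _. if k = l then 1 else 0"]) (auto intro: polynomial_fn.intros)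
  next
    case (add p q)
    then obtain D E where D: "\<And>z. (p has_derivative (\<lambda>v. \<Sum>k\<in>UNIV. v $ k * D k z)) (at z)"
        "\<And>k. polynomial_fn (D k)"
      and E: "\<And>z. (q has_derivative (\<lambda>v. \<Sum>k\<in>UNIV. v $ k * E k z)) (at z)"
        "\<And>k. polynomial_fn (E k)" by blast
    have "((\<lambda>z. p z + q z) has_derivative (\<lambda>v. \<Sum>k\<in>UNIV. v $ k * (D k z + E k z))) (at z)" for z
      using has_derivative_add[OF D(1) E(1), of z] by (simp add: distrib_left sum.distrib)
    then show ?case
      using D(2) E(2)
      by (intro exI[of _ "\<lambda>k z. D k z + E k z"]) (auto intro: polynomial_fn.intros)
  next
    case (mult p q)
    then obtain D E where D: "\<And>z. (p has_derivative (\<lambda>v. \<Sum>k\<in>UNIV. v $ k * D k z)) (at z)"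
        "\<And>k. polynomial_fn (D k)"
      and E: "\<And>z. (q has_derivative (\<lambda>v. \<Sum>k\<in>UNIV. v $ k * E k z)) (at z)"
        "\<And>k. polynomial_fn (E k)" by blast
    have "((\<lambda>z. p z * q z) has_derivative (\<lambda>v. \<Sum>k\<in>UNIV. v $ k * (p z * E k z + D k z * q z))) (at z)" for z
      using has_derivative_mult[OF D(1) E(1), of z]
      by (simp add: distrib_left sum.distrib sum_distrib_left sum_distrib_right mult_ac)
    then show ?case
      using D(2) E(2) mult.hyps
      by (intro exI[of _ "\<lambda>k z. p z * E k z + D k z * q z"]) (auto intro!: polynomial_fn.intros)
  qed
  then show ?thesis using that by blast
qed

text \<open>The bound is stated for every positive \<open>\<epsilon>\<close> because the product
  case spends \<open>\<epsilon> / 2\<close> on each factor. The square is the form in which a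
  polynomial enters the weighted integral.\<close>

lemma polynomial_fn_growth:
  fixes p :: "complex ^ 'n \<Rightarrow> complex"
  assumes "polynomial_fn p" "\<epsilon> > 0"
  shows "\<exists>K\<ge>0. \<forall>z. (cmod (p z))\<^sup>2 \<le> K * exp (\<epsilon> * (norm z)\<^sup>2)"
  using assms
proof (induction arbitrary: \<epsilon>)
  case (const c)
  show ?case using const by (intro exI[of _ "(cmod c)\<^sup>2"]) (simp add: mult_le_cancel_left1)
next
  case (coord k)
  have "(cmod (z $ k))\<^sup>2 \<le> 1 / \<epsilon> * exp (\<epsilon> * (norm z)\<^sup>2)" for z :: "complex ^ 'n"
  proof -
    have "(cmod (z $ k))\<^sup>2 \<le> (norm z)\<^sup>2" by (simp add: power_mono Finite_Cartesian_Product.norm_nth_le)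
    also have "\<dots> = 1 / \<epsilon> * (\<epsilon> * (norm z)\<^sup>2)" using coord by simp
    also have "\<dots> \<le> 1 / \<epsilon> * exp (\<epsilon> * (norm z)\<^sup>2)"
      using coord exp_ge_add_one_self[of "\<epsilon> * (norm z)\<^sup>2"]
      by (intro mult_left_mono) (linarith, simp)
    finally show ?thesis .
  qed
  then show ?case using coord by (intro exI[of _ "1 / \<epsilon>"]) simp
next
  case (add p q)
  then obtain K L where K: "K \<ge> 0" "\<And>z. (cmod (p z))\<^sup>2 \<le> K * exp (\<epsilon> * (norm z)\<^sup>2)"
    and L: "L \<ge> 0" "\<And>z. (cmod (q z))\<^sup>2 \<le> L * exp (\<epsilon> * (norm z)\<^sup>2)" by blast
  have "(cmod (p z + q z))\<^sup>2 \<le> (2 * K + 2 * L) * exp (\<epsilon> * (norm z)\<^sup>2)" for z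
  proof -
    have "(cmod (p z + q z))\<^sup>2 \<le> (cmod (p z) + cmod (q z))\<^sup>2"
      by (simp add: power_mono norm_triangle_ineq)
    also have "\<dots> \<le> 2 * (cmod (p z))\<^sup>2 + 2 * (cmod (q z))\<^sup>2"
      using sum_squares_bound[of "cmod (p z)" "cmod (q z)"] by (simp add: power2_sum)
    also have "\<dots> \<le> (2 * K + 2 * L) * exp (\<epsilon> * (norm z)\<^sup>2)"
      using K(2)[of z] L(2)[of z] by (simp add: distrib_right)
    finally show ?thesis .
  qed
  then show ?case using K(1) L(1) by (intro exI[of _ "2 * K + 2 * L"]) simp
next
  case (mult p q)
  have "\<epsilon> / 2 > 0" using mult.prems by simp
  then obtain K L where K: "K \<ge> 0" "\<And>z. (cmod (p z))\<^sup>2 \<le> K * exp (\<epsilon> / 2 * (norm z)\<^sup>2)"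
    and L: "L \<ge> 0" "\<And>z. (cmod (q z))\<^sup>2 \<le> L * exp (\<epsilon> / 2 * (norm z)\<^sup>2)"
    using mult.IH by meson
  have "(cmod (p z * q z))\<^sup>2 \<le> (K * L) * exp (\<epsilon> * (norm z)\<^sup>2)" for z
  proof -
    have "(cmod (p z * q z))\<^sup>2 \<le> (K * exp (\<epsilon> / 2 * (norm z)\<^sup>2)) * (L * exp (\<epsilon> / 2 * (norm z)\<^sup>2))"
      unfolding norm_mult power_mult_distrib using K L by (intro mult_mono) auto
    also have "\<dots> = K * L * (exp (\<epsilon> / 2 * (norm z)\<^sup>2) * exp (\<epsilon> / 2 * (norm z)\<^sup>2))"
      by (simp only: mult_ac)
    also have "\<dots> = K * L * exp (\<epsilon> * (norm z)\<^sup>2)"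
      by (simp add: exp_add[symmetric])
    finally show ?thesis .
  qed
  then show ?case using K(1) L(1) by (intro exI[of _ "K * L"]) simp
qed

section \<open>Integrability of Gaussians\<close>

lemma integrable_gaussian_real:
  fixes c :: real
  assumes "c > 0"
  shows "integrable lborel (\<lambda>x. exp (- c * x\<^sup>2))"
proof -
  \<comment> \<open>The variance \<open>1 / (2 * c)\<close> makes the exponent of the normal density
    equal to \<open>- c * x\<^sup>2\<close>.\<close>
  define \<sigma> where "\<sigma> = sqrt (1 / (2 * c))"
  have s: "\<sigma>\<^sup>2 = 1 / (2 * c)" and s0: "\<sigma> > 0" using assms by (simp_all add: \<sigma>_def)
  have "exp (- c * x\<^sup>2) = sqrt (2 * pi * \<sigma>\<^sup>2) * normal_density 0 \<sigma> x" for x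
    using assms by (simp add: normal_density_def s)
  then show ?thesis using s0 by simp
qed

text \<open>The squared norm is a sum over the basis, so the Gaussian is a product of
  one-dimensional ones and its integral factors.\<close>

lemma integrable_gaussian:
  assumes "c > 0"
  shows "integrable lborel (\<lambda>z :: 'a :: euclidean_space. exp (- c * (norm z)\<^sup>2))"
proof (rule integrableI_nonneg)
  have "ennreal (exp (- c * (norm z)\<^sup>2)) = ennreal (\<Prod>b\<in>Basis. exp (- c * (z \<bullet> b)\<^sup>2))" for z :: 'a
  proof -
    have "(norm z)\<^sup>2 = (\<Sum>b\<in>Basis. (z \<bullet> b)\<^sup>2)"
      unfolding power2_norm_eq_inner using euclidean_inner[of z z] by (simp add: power2_eq_square)
    then show ?thesis by (simp add: exp_sum[symmetric] sum_distrib_left sum_negf)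
  qed
  then have "(\<integral>\<^sup>+ z. ennreal (exp (- c * (norm (z :: 'a))\<^sup>2)) \<partial>lborel)
      = (\<Prod>b\<in>(Basis :: 'a set). \<integral>\<^sup>+ x. ennreal (exp (- c * x\<^sup>2)) \<partial>lborel)"
    using nn_integral_lborel_prod[where f = "\<lambda>(_ :: 'a) x. ennreal (exp (- c * x\<^sup>2))"]
    by (simp add: prod_ennreal[symmetric])
  also have "\<dots> < \<infinity>"
  proof -
    have "(\<integral>\<^sup>+ x. ennreal (exp (- c * x\<^sup>2)) \<partial>lborel) < \<infinity>"
      using integrable_gaussian_real[OF assms] by (simp add: integrable_iff_bounded)
    then show ?thesis by (simp add: power_less_top_ennreal)
  qed
  finally show "(\<integral>\<^sup>+ z. ennreal (exp (- c * (norm (z :: 'a))\<^sup>2)) \<partial>lborel) < \<infinity>" .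
qed auto

text \<open>The weight with its two coefficient matrices as parameters, so that the analysis can be
  phrased through coercivity and symmetry of these matrices.\<close>

definition quad_weight :: "complex ^ 'n ^ 'n \<Rightarrow> complex ^ 'n ^ 'n \<Rightarrow> complex ^ 'n \<Rightarrow> real" where
  "quad_weight P S z = Re (bilin z (P *v cnj_vec z)) + Re (bilin z (S *v z))"

lemma continuous_on_bilin [continuous_intros]:
  assumes "continuous_on A f" "continuous_on A g"
  shows "continuous_on A (\<lambda>x. bilin (f x) (g x))"
  unfolding bilin_def by (intro continuous_intros assms)

lemma continuous_on_mult_vec [continuous_intros]:
  fixes M :: "complex ^ 'n ^ 'm"
  assumes "continuous_on A f"
  shows "continuous_on A (\<lambda>x. M *v f x)"
  unfolding matrix_vector_mult_def by (intro continuous_intros assms)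

lemma continuous_on_cnj_vec [continuous_intros]:
  assumes "continuous_on A f"
  shows "continuous_on A (\<lambda>x. cnj_vec (f x))"
  unfolding cnj_vec_def by (intro continuous_intros assms)

lemma continuous_on_quad_weight [continuous_intros]: "continuous_on A (quad_weight P S)"
  unfolding quad_weight_def by (intro continuous_intros)

lemma entire_poly_exp:
  assumes "polynomial_fn p" "polynomial_fn q"
  obtains D where "\<And>k. polynomial_fn (D k)"
    "entire (\<lambda>z. p z * exp (q z))"
    "\<And>k. partial_deriv k (\<lambda>z. p z * exp (q z)) = (\<lambda>z. D k z * exp (q z))"
proof -
  obtain D where D: "\<And>z. (p has_derivative (\<lambda>v. \<Sum>k\<in>UNIV. v $ k * D k z)) (at z)"
      "\<And>k. polynomial_fn (D k)" using polynomial_fn_derivative[OF assms(1)] by blast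
  obtain E where E: "\<And>z. (q has_derivative (\<lambda>v. \<Sum>k\<in>UNIV. v $ k * E k z)) (at z)"
      "\<And>k. polynomial_fn (E k)" using polynomial_fn_derivative[OF assms(2)] by blast
  have "((\<lambda>z. exp (q z)) has_derivative (\<lambda>v. exp (q z) * (\<Sum>k\<in>UNIV. v $ k * E k z))) (at z)" for z
    by (rule has_derivative_compose[OF E(1)])
       (use DERIV_exp[of "q z"] in \<open>simp add: has_field_derivative_def\<close>)
  from has_derivative_mult[OF D(1) this]
  have d: "((\<lambda>z. p z * exp (q z)) has_derivative
      (\<lambda>v. \<Sum>k\<in>UNIV. v $ k * ((D k z + p z * E k z) * exp (q z)))) (at z)" for z
    by (simp add: sum.distrib distrib_left distrib_right sum_distrib_left sum_distrib_right mult_ac add.commute)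
  show thesis
  proof (rule that[of "\<lambda>k z. D k z + p z * E k z"])
    show "polynomial_fn (\<lambda>z. D k z + p z * E k z)" for k
      by (intro polynomial_fn.intros D E assms)
    show "entire (\<lambda>z. p z * exp (q z))" using entireI(1)[OF d] .
    show "partial_deriv k (\<lambda>z. p z * exp (q z)) = (\<lambda>z. (D k z + p z * E k z) * exp (q z))" for k
      using entireI(2)[OF d] by blast
  qed
qed

section \<open>Polynomials times a Gaussian as test functions in the weighted space\<close>

context
  fixes P S :: "complex ^ 'n ^ 'n" and c :: real
  assumes c: "c > 0"
    and P: "\<And>z. c * (norm z)\<^sup>2 \<le> Re (bilin z (P *v cnj_vec z))"
begin

text \<open>The squared modulus of \<open>exp (bilin z (S *v z))\<close> cancels the part of the
  weight coming from \<open>S\<close>. Of the remaining decay at rate \<open>2 * c\<close>, half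
  absorbs the polynomial and half is left as an integrable Gaussian.\<close>

lemma poly_exp_in_H_space:
  assumes p: "polynomial_fn p"
  shows "(\<lambda>z. p z * exp (bilin z (S *v z))) \<in> H_space (quad_weight P S)"
proof -
  let ?F = "\<lambda>z. p z * exp (bilin z (S *v z))"
  have ent: "entire ?F" using entire_poly_exp[OF p polynomial_fn_bilin] by blast
  obtain K where K: "K \<ge> 0" "\<And>z. (cmod (p z))\<^sup>2 \<le> K * exp (c * (norm z)\<^sup>2)"
    using polynomial_fn_growth[OF p c] by blast
  have "integrable lborel (\<lambda>z. (cmod (?F z))\<^sup>2 * exp (- 2 * quad_weight P S z))"
  proof (rule Bochner_Integration.integrable_bound)
    show "integrable lborel (\<lambda>z :: complex ^ 'n. K * exp (- c * (norm z)\<^sup>2))"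
      using integrable_gaussian[OF c, where 'a = "complex ^ 'n"] by simp
    show "(\<lambda>z. (cmod (?F z))\<^sup>2 * exp (- 2 * quad_weight P S z)) \<in> borel_measurable lborel"
      using entire_continuous[OF ent, of UNIV]
      by (auto intro!: borel_measurable_continuous_onI continuous_intros)
    show "AE z in lborel. norm ((cmod (?F z))\<^sup>2 * exp (- 2 * quad_weight P S z))
        \<le> norm (K * exp (- c * (norm z)\<^sup>2))"
    proof (rule AE_I2)
      fix z :: "complex ^ 'n"
      let ?r = "Re (bilin z (P *v cnj_vec z))"
      have "(cmod (?F z))\<^sup>2 * exp (- 2 * quad_weight P S z) = (cmod (p z))\<^sup>2 * exp (- 2 * ?r)"
      proof -
        have "(cmod (exp (bilin z (S *v z))))\<^sup>2 * exp (- 2 * quad_weight P S z) = exp (- 2 * ?r)"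
          by (simp add: quad_weight_def power2_eq_square exp_add[symmetric] exp_diff[symmetric])
        then show ?thesis by (simp add: norm_mult power_mult_distrib mult.assoc)
      qed
      also have "\<dots> \<le> (K * exp (c * (norm z)\<^sup>2)) * exp (- 2 * (c * (norm z)\<^sup>2))"
        using K P[of z] by (intro mult_mono) auto
      also have "\<dots> = K * exp (- c * (norm z)\<^sup>2)"
        by (simp add: mult.assoc exp_add[symmetric])
      finally show "norm ((cmod (?F z))\<^sup>2 * exp (- 2 * quad_weight P S z))
          \<le> norm (K * exp (- c * (norm z)\<^sup>2))" using K(1) by simp
    qed
  qed
  with ent show ?thesis by (simp add: H_space_def)
qed

lemma poly_exp_in_op_domain:
  assumes p: "polynomial_fn p"
  shows "(\<lambda>z. p z * exp (bilin z (S *v z))) \<in> op_domain (quad_weight P S)"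
proof -
  obtain D where D: "\<And>k. polynomial_fn (D k)"
    "\<And>k. partial_deriv k (\<lambda>z. p z * exp (bilin z (S *v z))) = (\<lambda>z. D k z * exp (bilin z (S *v z)))"
    using entire_poly_exp[OF p polynomial_fn_bilin] by blast
  have "(\<lambda>z. z $ k * (p z * exp (bilin z (S *v z)))) \<in> H_space (quad_weight P S)" for k
    using poly_exp_in_H_space[OF polynomial_fn.mult[OF polynomial_fn.coord[of k] p]]
    by (simp add: mult.assoc)
  then show ?thesis
    unfolding op_domain_def using poly_exp_in_H_space p D by simp
qed

text \<open>Vanishing norm forces \<open>F\<close> to vanish almost everywhere; the set where it
  does not is open, and a nonempty open set is not negligible.\<close>

lemma H_inner_self_eq_0:
  assumes F: "F \<in> H_space (quad_weight P S)" and 0: "H_inner (quad_weight P S) F F = 0"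
  shows "F z = 0"
proof -
  let ?h = "\<lambda>z. (cmod (F z))\<^sup>2 * exp (- 2 * quad_weight P S z)"
  have ent: "entire F" and int: "integrable lborel ?h" using F by (auto simp: H_space_def)
  have "H_inner (quad_weight P S) F F = complex_of_real (LINT z|lborel. ?h z)"
    unfolding H_inner_def integral_complex_of_real[symmetric]
    by (simp add: complex_norm_square of_real_mult del: of_real_power)
  then have "(LINT z|lborel. ?h z) = 0" using 0 by simp
  then have ae: "AE z in lborel. ?h z = 0"
    using integral_nonneg_eq_0_iff_AE[OF int] by simp
  have op: "open {z. F z \<noteq> 0}"
    using entire_continuous[OF ent, of UNIV] open_Collect_neq[of F "\<lambda>_. 0"] by simp
  have "AE z in lborel. z \<notin> {z. F z \<noteq> 0}" using ae by simp
  then have "{z. F z \<noteq> 0} \<in> null_sets lborel"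
    using AE_iff_null_sets[of "{z. F z \<noteq> 0}" lborel] op by simp
  then have "negligible {z. F z \<noteq> 0}"
    using negligible_iff_null_sets null_sets_completionI by blast
  then have "{z. F z \<noteq> 0} = {}" using open_not_negligible[OF op] by blast
  then show ?thesis by blast
qed

text \<open>This gives uniqueness of the adjoint. A first-order operator maps each test function to
  another one, so the image can be paired with itself and must vanish. The polynomials 1 and
  \<open>z $ l\<close> then separate the coefficients.\<close>

lemma first_order_op_coeffs_zero:
  assumes 0: "\<And>F G. F \<in> op_domain (quad_weight P S) \<Longrightarrow> G \<in> op_domain (quad_weight P S) \<Longrightarrow>
    H_inner (quad_weight P S) F (first_order_op a b d G) = 0"
  shows "a = 0" "b = 0" "d = 0"
proof -
  define g where "g z = exp (bilin z (S *v z))" for z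
  have van: "first_order_op a b d (\<lambda>z. p z * g z) z = 0" if p: "polynomial_fn p" for p z
  proof -
    obtain D where D: "\<And>k. polynomial_fn (D k)"
      "\<And>k. partial_deriv k (\<lambda>z. p z * g z) = (\<lambda>z. D k z * g z)"
      using entire_poly_exp[OF p polynomial_fn_bilin] unfolding g_def by blast
    let ?r = "\<lambda>z. (\<Sum>k\<in>UNIV. a $ k * D k z) + (\<Sum>k\<in>UNIV. b $ k * z $ k) * p z + d * p z"
    have r: "first_order_op a b d (\<lambda>z. p z * g z) = (\<lambda>z. ?r z * g z)"
      unfolding fun_eq_iff first_order_op_def D
      by (simp add: sum_distrib_right distrib_right mult.assoc)
    have rp: "polynomial_fn ?r"
      by (intro polynomial_fn.add polynomial_fn.mult polynomial_fn_sum p D polynomial_fn.const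
          polynomial_fn.coord)
    have "(\<lambda>z. ?r z * g z) \<in> op_domain (quad_weight P S)"
      "(\<lambda>z. p z * g z) \<in> op_domain (quad_weight P S)"
      "(\<lambda>z. ?r z * g z) \<in> H_space (quad_weight P S)"
      unfolding g_def by (rule poly_exp_in_op_domain[OF rp] poly_exp_in_op_domain[OF p]
          poly_exp_in_H_space[OF rp])+
    then show ?thesis
      unfolding r using H_inner_self_eq_0 0 r by metis
  qed
  have pd: "partial_deriv k (\<lambda>z. z $ l * g z) z = (if k = l then g z else 0) + z $ l * partial_deriv k g z"
    for k l z
  proof -
    have "entire (\<lambda>z. 1 * g z)"
      unfolding g_def by (rule entire_poly_exp[OF polynomial_fn.const polynomial_fn_bilin])
    then have "entire g" by simp
    from has_derivative_mult[OF bounded_linear_imp_has_derivative[OF bounded_linear_vec_nth[of l]]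
        entire_has_derivative[OF this, of z]]
    have "((\<lambda>z. z $ l * g z) has_derivative (\<lambda>v. \<Sum>k\<in>UNIV. v $ k * ((if k = l then g z else 0)
        + z $ l * partial_deriv k g z))) (at z)"
      by (simp add: distrib_left sum.distrib if_distrib[of "\<lambda>x. _ * x"] sum_distrib_left mult_ac add.commute
          cong: if_cong)
    from partial_deriv_eqI[OF this] show ?thesis .
  qed
  have g0: "g z \<noteq> 0" for z by (simp add: g_def)
  have 1: "first_order_op a b d g z = 0" for z
    using van[OF polynomial_fn.const[of 1]] by simp
  have 2: "first_order_op a b d (\<lambda>z. z $ l * g z) z = a $ l * g z + z $ l * first_order_op a b d g z" for l z
    unfolding first_order_op_def pd
    by (simp add: distrib_left sum.distrib if_distrib[of "\<lambda>x. _ * x"]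
        sum_distrib_left mult_ac cong: if_cong)
  have a: "a $ l = 0" for l
    using 2[of l 0] van[OF polynomial_fn.coord[of l], of 0] g0[of 0] by (simp add: 1)
  then show "a = 0" by (simp add: vec_eq_iff)
  \<comment> \<open>With \<open>a\<close> gone, the operator is multiplication by an affine
    function; its values at 0 and at the unit vectors give \<open>d\<close> and
    \<open>b\<close>.\<close>
  have 3: "(\<Sum>k\<in>UNIV. b $ k * z $ k) + d = 0" for z
    using 1[of z] g0[of z] by (simp add: first_order_op_def a distrib_right[symmetric])
  show d: "d = 0" using 3[of 0] by simp
  have "b $ l = 0" for l
    using 3[of "axis l 1"] sum_axis_mult[of l 1 "\<lambda>k. b $ k"] d by (simp add: mult.commute)
  then show "b = 0" by (simp add: vec_eq_iff)
qed

end

subsection \<open>Integration by parts\<close>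

lemma lborel_translate:
  fixes f :: "'a :: euclidean_space \<Rightarrow> 'b :: {banach, second_countable_topology}"
  assumes "f \<in> borel_measurable borel"
  shows "integrable lborel (\<lambda>x. f (x + a)) \<longleftrightarrow> integrable lborel f"
    and "(LINT x|lborel. f (x + a)) = (LINT x|lborel. f x)"
proof -
  have "integrable (distr lborel borel ((+) a)) f = integrable lborel (\<lambda>x. f (a + x))"
    by (rule integrable_distr_eq) (use assms in auto)
  then show "integrable lborel (\<lambda>x. f (x + a)) \<longleftrightarrow> integrable lborel f"
    by (simp add: lborel_distr_plus add.commute)
  have "integral\<^sup>L (distr lborel borel ((+) a)) f = (LINT x|lborel. f (a + x))"
    by (rule integral_distr) (use assms in auto)
  then show "(LINT x|lborel. f (x + a)) = (LINT x|lborel. f x)"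
    by (simp add: lborel_distr_plus add.commute)
qed

text \<open>Integrate \<open>u (x + b) - u x\<close>, written as the integral of \<open>v\<close> along the segment, over
  the whole space: the left side integrates to zero by translation invariance, and Fubini gives
  the integral of \<open>v\<close> on the right.\<close>

lemma integral_directional_derivative_eq_0:
  fixes u v :: "'a :: euclidean_space \<Rightarrow> 'b :: euclidean_space"
  assumes deriv: "\<And>x. (u has_derivative u' x) (at x)" and v: "\<And>x. u' x b = v x"
    and cont: "continuous_on UNIV v"
    and iu: "integrable lborel u" and iv: "integrable lborel v"
  shows "(LINT x|lborel. v x) = 0"
proof -
  define W where "W = (\<lambda>(s :: real) x. indicator {0..1} s *\<^sub>R v (x + s *\<^sub>R b))"
  have vm: "v \<in> borel_measurable borel"
    using cont by (rule borel_measurable_continuous_onI)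
  have um: "u \<in> borel_measurable borel"
    by (intro borel_measurable_continuous_onI continuous_at_imp_continuous_on ballI)
      (rule has_derivative_continuous[OF deriv])
  have Wm: "case_prod W \<in> borel_measurable (lborel \<Otimes>\<^sub>M lborel)"
  proof -
    have "(\<lambda>p. v (snd p + fst p *\<^sub>R b)) \<in> borel_measurable (borel :: (real \<times> 'a) measure)"
      by (intro borel_measurable_continuous_onI continuous_on_compose2[OF cont] continuous_intros) auto
    then have [measurable]: "(\<lambda>p. v (snd p + fst p *\<^sub>R b)) \<in> borel_measurable (lborel \<Otimes>\<^sub>M lborel)"
      by (simp add: borel_prod[symmetric] cong: measurable_cong_sets)
    show ?thesis unfolding W_def case_prod_unfold by measurable
  qed
  have trans: "integrable lborel (\<lambda>x. v (x + s *\<^sub>R b))"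
    "(LINT x|lborel. v (x + s *\<^sub>R b)) = (LINT x|lborel. v x)"
    "(LINT x|lborel. norm (v (x + s *\<^sub>R b))) = (LINT x|lborel. norm (v x))" for s
    using lborel_translate[OF vm] lborel_translate(2)[of "\<lambda>x. norm (v x)"] iv vm by auto
  have I1: "integrable lborel (indicator {0..1} :: real \<Rightarrow> real)"
    by simp
  have Wi: "integrable (lborel \<Otimes>\<^sub>M lborel) (case_prod W)"
  proof (rule lborel_pair.Fubini_integrable[OF Wm])
    \<comment> \<open>By translation invariance the inner integral does not depend on
      \<open>s\<close> inside the unit interval, which gives absolute integrability on the
      product.\<close>
    have "(\<lambda>s. LINT x|lborel. norm (case_prod W (s, x)))
       = (\<lambda>s. indicator {0..1} s *\<^sub>R (LINT x|lborel. norm (v x)))"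
      by (simp add: W_def trans fun_eq_iff)
    then show "integrable lborel (\<lambda>s. LINT x|lborel. norm (case_prod W (s, x)))"
      using I1 by simp
    show "AE s in lborel. integrable lborel (\<lambda>x. case_prod W (s, x))"
      by (simp add: W_def trans)
  qed
  have line: "(LINT s|lborel. W s x) = u (x + b) - u x" for x
  proof -
    have "(LINT s|lborel. indicator {0..1} s *\<^sub>R v (x + s *\<^sub>R b)) = u (x + 1 *\<^sub>R b) - u (x + 0 *\<^sub>R b)"
    proof (rule integral_FTC_Icc)
      show "((\<lambda>s. u (x + s *\<^sub>R b)) has_vector_derivative v (x + s *\<^sub>R b)) (at s within {0..1})" for s
      proof -
        have "((\<lambda>s. u (x + s *\<^sub>R b)) has_derivative (\<lambda>h. u' (x + s *\<^sub>R b) (h *\<^sub>R b))) (at s)"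
          by (rule has_derivative_compose[OF _ deriv]) (auto intro!: derivative_eq_intros)
        moreover have "(\<lambda>h. u' (x + s *\<^sub>R b) (h *\<^sub>R b)) = (\<lambda>h. h *\<^sub>R v (x + s *\<^sub>R b))"
          using has_derivative_linear[OF deriv] v by (simp add: linear_scale)
        ultimately show ?thesis
          by (simp add: has_vector_derivative_def has_derivative_at_withinI)
      qed
      show "continuous_on {0..1} (\<lambda>s. v (x + s *\<^sub>R b))"
        by (intro continuous_on_compose2[OF cont] continuous_intros) auto
    qed auto
    then show ?thesis by (simp add: W_def)
  qed
  have "(LINT x|lborel. v x) = (LINT s|lborel. LINT x|lborel. W s x)"
    by (simp add: W_def trans)
  also have "\<dots> = (LINT x|lborel. LINT s|lborel. W s x)"
    using lborel_pair.Fubini_integral[OF Wi] by simp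
  also have "\<dots> = (LINT x|lborel. u (x + b) - u x)"
    by (simp add: line)
  also have "\<dots> = 0"
    using lborel_translate[OF um] iu by simp
  finally show ?thesis .
qed

section \<open>The derivative of the weight\<close>

lemma has_derivative_bilin:
  fixes f g :: "'a :: real_normed_vector \<Rightarrow> complex ^ 'n"
  assumes "(f has_derivative f') (at x)" "(g has_derivative g') (at x)"
  shows "((\<lambda>x. bilin (f x) (g x)) has_derivative (\<lambda>v. bilin (f x) (g' v) + bilin (f' v) (g x))) (at x)"
proof -
  have "((\<lambda>x. f x $ j * g x $ j) has_derivative (\<lambda>v. f x $ j * g' v $ j + f' v $ j * g x $ j)) (at x)" for j
    by (intro has_derivative_mult bounded_linear.has_derivative[OF bounded_linear_vec_nth] assms)
  then show ?thesis
    unfolding bilin_def sum.distrib[symmetric] by (intro has_derivative_sum)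
qed

lemma bounded_linear_mult_vec: "bounded_linear ((*v) (M :: complex ^ 'n ^ 'm))"
  by (rule linear_conv_bounded_linear[THEN iffD1], rule linearI)
     (simp_all add: vec_eq_iff matrix_vector_mult_def distrib_left sum.distrib scaleR_right.sum)

lemma bounded_linear_cnj_vec: "bounded_linear (cnj_vec :: complex ^ 'n \<Rightarrow> _)"
  by (rule linear_conv_bounded_linear[THEN iffD1], rule linearI)
     (simp_all add: vec_eq_iff)

lemma bilin_commute: "bilin x y = bilin y x"
  by (simp add: bilin_def mult.commute)

lemma bilin_add_right: "bilin x (y + z) = bilin x y + bilin x z"
  by (simp add: bilin_def distrib_left sum.distrib)

lemma bilin_axis: "bilin (axis k w) y = w * y $ k"
  by (simp add: bilin_def sum_axis_mult)

lemma cnj_mult_vec: "cnj_vec (M *v z) = cnj_mat M *v cnj_vec z"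
  by (simp add: vec_eq_iff matrix_vector_mult_def)

lemma cnj_vec_cnj_vec [simp]: "cnj_vec (cnj_vec z) = z"
  by (simp add: vec_eq_iff)

text \<open>The product rule gives two terms for each form. They are conjugate for the Hermitian
  \<open>P\<close> and equal for the symmetric \<open>S\<close>, so under the real part each pair
  merges into a factor 2.\<close>

lemma has_derivative_quad_weight:
  fixes P S :: "complex ^ 'n ^ 'n"
  assumes P: "conj_transpose P = P" and S: "transpose S = S"
  shows "(quad_weight P S has_derivative
      (\<lambda>v. 2 * Re (bilin v (P *v cnj_vec z + S *v z)))) (at z)"
proof -
  have "(quad_weight P S has_derivative
     (\<lambda>v. Re (bilin z (P *v cnj_vec v) + bilin v (P *v cnj_vec z))
        + Re (bilin z (S *v v) + bilin v (S *v z)))) (at z)"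
    unfolding quad_weight_def
    by (intro has_derivative_add bounded_linear.has_derivative[OF bounded_linear_Re]
        has_derivative_bilin has_derivative_ident
        bounded_linear.has_derivative[OF bounded_linear_mult_vec]
        bounded_linear.has_derivative[OF bounded_linear_cnj_vec])
  moreover have "bilin z (P *v cnj_vec v) = cnj (bilin v (P *v cnj_vec z))" for v
  proof -
    have "transpose P = cnj_mat P"
      using arg_cong[OF P, of cnj_mat] by (simp add: conj_transpose_def cnj_mat_transpose)
    then have "bilin z (P *v cnj_vec v) = bilin (cnj_vec v) (cnj_mat P *v z)"
      by (metis bilin_commute bilin_mult_vec transpose_matrix_vector)
    also have "\<dots> = cnj (bilin v (P *v cnj_vec z))"
      using cnj_mult_vec[of P "cnj_vec z"] by (simp add: bilin_def vec_eq_iff)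
    finally show ?thesis .
  qed
  moreover have "bilin z (S *v v) = bilin v (S *v z)" for v
    by (metis S bilin_commute bilin_mult_vec transpose_matrix_vector)
  ultimately show ?thesis
    by (simp add: bilin_add_right)
qed

lemma integrable_H_inner:
  assumes f: "f \<in> H_space \<phi>" and g: "g \<in> H_space \<phi>" and \<phi>: "continuous_on UNIV \<phi>"
  shows "integrable lborel (\<lambda>z. f z * cnj (g z) * complex_of_real (exp (- 2 * \<phi> z)))"
proof (rule Bochner_Integration.integrable_bound)
  show "integrable lborel (\<lambda>z. (cmod (f z))\<^sup>2 * exp (- 2 * \<phi> z) + (cmod (g z))\<^sup>2 * exp (- 2 * \<phi> z))"
    using f g by (auto simp: H_space_def)
  show "(\<lambda>z. f z * cnj (g z) * complex_of_real (exp (- 2 * \<phi> z))) \<in> borel_measurable lborel"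
    using f g \<phi> entire_continuous[of f UNIV] entire_continuous[of g UNIV]
    by (auto simp: H_space_def intro!: borel_measurable_continuous_onI continuous_intros)
  show "AE z in lborel. norm (f z * cnj (g z) * complex_of_real (exp (- 2 * \<phi> z)))
      \<le> norm ((cmod (f z))\<^sup>2 * exp (- 2 * \<phi> z) + (cmod (g z))\<^sup>2 * exp (- 2 * \<phi> z))"
  proof (rule AE_I2)
    fix z
    have "cmod (f z) * cmod (g z) \<le> (cmod (f z))\<^sup>2 + (cmod (g z))\<^sup>2"
      using sum_squares_bound[of "cmod (f z)" "cmod (g z)"] mult_nonneg_nonneg[OF norm_ge_zero[of "f z"] norm_ge_zero[of "g z"]]
      by linarith
    then have "cmod (f z) * cmod (g z) * exp (- 2 * \<phi> z)
        \<le> ((cmod (f z))\<^sup>2 + (cmod (g z))\<^sup>2) * exp (- 2 * \<phi> z)"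
      by (rule mult_right_mono) simp
    then show "norm (f z * cnj (g z) * complex_of_real (exp (- 2 * \<phi> z)))
      \<le> norm ((cmod (f z))\<^sup>2 * exp (- 2 * \<phi> z) + (cmod (g z))\<^sup>2 * exp (- 2 * \<phi> z))"
      by (simp add: norm_mult distrib_right)
  qed
qed

lemma op_domainD:
  assumes "F \<in> op_domain \<phi>"
  shows "F \<in> H_space \<phi>" "(\<lambda>z. z $ k * F z) \<in> H_space \<phi>" "partial_deriv k F \<in> H_space \<phi>"
    "entire F" "entire (partial_deriv k F)"
  using assms by (auto simp: op_domain_def H_space_def)

text \<open>The derivative of \<open>F * cnj G * exp (- 2 * \<phi>)\<close> along a real direction
  integrates to zero. The directions \<open>axis k 1\<close> and \<open>axis k \<i>\<close> together
  isolate the holomorphic derivative of \<open>F\<close>, and the holomorphic derivative of the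
  weight contributes the terms with \<open>P\<close> and \<open>S\<close>.\<close>

lemma H_inner_partial_deriv:
  fixes P S :: "complex ^ 'n ^ 'n"
  assumes P: "conj_transpose P = P" and S: "transpose S = S"
    and F: "F \<in> op_domain (quad_weight P S)" and G: "G \<in> op_domain (quad_weight P S)"
  shows "H_inner (quad_weight P S) (partial_deriv k F) G =
    2 * (\<Sum>l\<in>UNIV. P $ k $ l * H_inner (quad_weight P S) F (\<lambda>z. z $ l * G z)) +
    2 * (\<Sum>l\<in>UNIV. S $ k $ l * H_inner (quad_weight P S) (\<lambda>z. z $ l * F z) G)"
proof -
  define \<phi> where "\<phi> = quad_weight P S"
  define e where "e z = complex_of_real (exp (- 2 * \<phi> z))" for z
  define m where "m z = (P *v cnj_vec z + S *v z) $ k" for z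
  define u where "u z = F z * cnj (G z) * e z" for z
  \<comment> \<open>\<open>v w\<close> is the derivative of \<open>u\<close> in the direction
    \<open>axis k w\<close>; \<open>m\<close> is the holomorphic \<open>k\<close>-th derivative of
    the weight.\<close>
  define v where "v w z = w * partial_deriv k F z * cnj (G z) * e z
      + F z * cnj (w * partial_deriv k G z) * e z - 4 * complex_of_real (Re (w * m z)) * u z" for w z
  have c: "continuous_on UNIV \<phi>" unfolding \<phi>_def by (rule continuous_on_quad_weight)
  note dF = op_domainD[OF F, folded \<phi>_def] and dG = op_domainD[OF G, folded \<phi>_def]
  note int = integrable_H_inner[OF _ _ c, folded e_def]
  have cm: "continuous_on UNIV m" unfolding m_def by (intro continuous_intros)
  have ce: "continuous_on UNIV e" unfolding e_def by (intro continuous_intros c)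
  note cF = entire_continuous[OF dF(4)] entire_continuous[OF dF(5)]
    and cG = entire_continuous[OF dG(4)] entire_continuous[OF dG(5)]
  have cu: "continuous_on UNIV u" unfolding u_def by (intro continuous_intros cF cG ce)
  have cv: "continuous_on UNIV (v w)" for w unfolding v_def
    by (intro continuous_intros cF cG ce cu cm)
  have i1: "integrable lborel (\<lambda>z. partial_deriv k F z * cnj (G z) * e z)"
    by (rule int[OF dF(3) dG(1)])
  have i2: "integrable lborel (\<lambda>z. F z * cnj (partial_deriv k G z) * e z)"
    by (rule int[OF dF(1) dG(3)])
  have i3: "integrable lborel (\<lambda>z. F z * cnj (z $ l * G z) * e z)" for l
    by (rule int[OF dF(1) dG(2)])
  have i4: "integrable lborel (\<lambda>z. (z $ l * F z) * cnj (G z) * e z)" for l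
    by (rule int[OF dF(2) dG(1)])
  have iu: "integrable lborel u" unfolding u_def by (rule int[OF dF(1) dG(1)])
  have mu: "m z * u z = (\<Sum>l\<in>UNIV. P $ k $ l * (F z * cnj (z $ l * G z) * e z))
      + (\<Sum>l\<in>UNIV. S $ k $ l * ((z $ l * F z) * cnj (G z) * e z))" for z
    by (simp add: m_def u_def matrix_vector_mult_def distrib_left distrib_right sum_distrib_left
        sum_distrib_right mult_ac)
  have imu: "integrable lborel (\<lambda>z. m z * u z)"
    unfolding mu using i3 i4 by simp
  \<comment> \<open>Taking the real part is not complex-linear, so integrability is obtained by
    domination from that of \<open>m z * u z\<close>.\<close>
  have ire: "integrable lborel (\<lambda>z. complex_of_real (Re (w * m z)) * u z)" for w
  proof (rule Bochner_Integration.integrable_bound)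
    show "integrable lborel (\<lambda>z. w * (m z * u z))" using imu by simp
    show "(\<lambda>z. complex_of_real (Re (w * m z)) * u z) \<in> borel_measurable lborel"
      using cm cu by (auto intro!: borel_measurable_continuous_onI continuous_intros)
    show "AE z in lborel. norm (complex_of_real (Re (w * m z)) * u z) \<le> norm (w * (m z * u z))"
    proof (rule AE_I2)
      fix z
      have "\<bar>Re (w * m z)\<bar> * cmod (u z) \<le> cmod (w * m z) * cmod (u z)"
        by (rule mult_right_mono[OF abs_Re_le_cmod]) simp
      then show "norm (complex_of_real (Re (w * m z)) * u z) \<le> norm (w * (m z * u z))"
        by (simp add: norm_mult mult.assoc del: times_complex.sel)
    qed
  qed
  have "integrable lborel (v w)" for w
  proof -
    have "v w = (\<lambda>z. w * (partial_deriv k F z * cnj (G z) * e z)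
        + cnj w * (F z * cnj (partial_deriv k G z) * e z)
        - 4 * (complex_of_real (Re (w * m z)) * u z))"
      by (simp add: v_def fun_eq_iff mult_ac)
    then show ?thesis using i1 i2 ire by simp
  qed
  have z: "(LINT z|lborel. v w z) = 0" for w
  proof (rule integral_directional_derivative_eq_0[where u=u and b="axis k w" and u'=
        "\<lambda>z h. F z * cnj (G z) * (complex_of_real (- 2 * (2 * Re (bilin h (P *v cnj_vec z + S *v z)))) * e z)
         + (F z * cnj (\<Sum>l\<in>UNIV. h $ l * partial_deriv l G z)
            + (\<Sum>l\<in>UNIV. h $ l * partial_deriv l F z) * cnj (G z)) * e z"])
    fix z
    have "((\<lambda>z. exp (- 2 * \<phi> z)) has_derivative
        (\<lambda>h. exp (- 2 * \<phi> z) * (- 2 * (2 * Re (bilin h (P *v cnj_vec z + S *v z)))))) (at z)"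
    proof (rule has_derivative_compose[where f = "\<lambda>z. - 2 * \<phi> z" and g = exp
          and f' = "\<lambda>h. - 2 * (2 * Re (bilin h (P *v cnj_vec z + S *v z)))"
          and g' = "(*) (exp (- 2 * \<phi> z))"])
      show "((\<lambda>z. - 2 * \<phi> z) has_derivative
          (\<lambda>h. - 2 * (2 * Re (bilin h (P *v cnj_vec z + S *v z))))) (at z)"
        unfolding \<phi>_def by (intro has_derivative_mult_right has_derivative_quad_weight P S)
      show "(exp has_derivative (*) (exp (- 2 * \<phi> z))) (at (- 2 * \<phi> z))"
        using DERIV_exp by (simp add: has_field_derivative_def)
    qed
    from bounded_linear.has_derivative[OF bounded_linear_of_real this]
    have "(e has_derivative (\<lambda>h. complex_of_real (- 2 * (2 * Re (bilin h (P *v cnj_vec z + S *v z)))) * e z)) (at z)"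
      by (simp add: e_def[abs_def] mult.commute)
    then show "(u has_derivative (\<lambda>h. F z * cnj (G z) * (complex_of_real (- 2 * (2 * Re (bilin h (P *v cnj_vec z + S *v z)))) * e z)
         + (F z * cnj (\<Sum>l\<in>UNIV. h $ l * partial_deriv l G z)
            + (\<Sum>l\<in>UNIV. h $ l * partial_deriv l F z) * cnj (G z)) * e z)) (at z)"
      unfolding u_def
      by (intro has_derivative_mult bounded_linear.has_derivative[OF bounded_linear_cnj]
          entire_has_derivative dF dG)
    show "F z * cnj (G z) * (complex_of_real (- 2 * (2 * Re (bilin (axis k w) (P *v cnj_vec z + S *v z)))) * e z)
         + (F z * cnj (\<Sum>l\<in>UNIV. axis k w $ l * partial_deriv l G z)
            + (\<Sum>l\<in>UNIV. axis k w $ l * partial_deriv l F z) * cnj (G z)) * e z = v w z"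
      unfolding bilin_axis sum_axis_mult v_def u_def m_def by (simp add: algebra_simps)
  qed fact+
  \<comment> \<open>In \<open>v 1 z - \<i> * v \<i> z\<close> the derivative of \<open>G\<close>
    cancels because it enters with \<open>cnj w\<close>, the derivative of \<open>F\<close> is
    doubled, and the two real parts recombine to \<open>m z\<close>.\<close>
  have "partial_deriv k F z * cnj (G z) * e z = 2 * (m z * u z) + (v 1 z - \<i> * v \<i> z) / 2" for z
  proof -
    have "m z = complex_of_real (Re (m z)) + \<i> * complex_of_real (Im (m z))"
      by (rule complex_eq)
    then have "2 * (m z * u z) = 2 * (complex_of_real (Re (m z)) + \<i> * complex_of_real (Im (m z))) * u z"
      by (simp only: mult.assoc)
    then show ?thesis
      by (simp add: v_def algebra_simps add_divide_distrib diff_divide_distrib)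
  qed
  then have "H_inner \<phi> (partial_deriv k F) G
      = (LINT z|lborel. 2 * (m z * u z) + (v 1 z - \<i> * v \<i> z) / 2)"
    unfolding H_inner_def e_def[symmetric] by simp
  also have "\<dots> = 2 * (LINT z|lborel. m z * u z)"
    using imu \<open>\<And>w. integrable lborel (v w)\<close> z by simp
  also have "(LINT z|lborel. m z * u z) =
      (\<Sum>l\<in>UNIV. P $ k $ l * H_inner \<phi> F (\<lambda>z. z $ l * G z)) +
      (\<Sum>l\<in>UNIV. S $ k $ l * H_inner \<phi> (\<lambda>z. z $ l * F z) G)"
    unfolding mu H_inner_def e_def[symmetric] using i3 i4 by simp
  finally show ?thesis unfolding \<phi>_def by (simp add: distrib_left)
qed

subsection \<open>Adjoints\<close>

context
  fixes P S V :: "complex ^ 'n ^ 'n" and c :: real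
  assumes c: "c > 0"
    and pos: "\<And>z. c * (norm z)\<^sup>2 \<le> Re (bilin z (P *v cnj_vec z))"
    and P: "conj_transpose P = P" and S: "transpose S = S" and V: "V ** P = mat 1"
begin

lemma H_inner_first_order_op:
  assumes F: "F \<in> op_domain (quad_weight P S)" and G: "G \<in> op_domain (quad_weight P S)"
  shows "H_inner (quad_weight P S) (first_order_op a b d F) G =
      (\<Sum>k\<in>UNIV. a $ k * H_inner (quad_weight P S) (partial_deriv k F) G)
      + (\<Sum>k\<in>UNIV. b $ k * H_inner (quad_weight P S) (\<lambda>z. z $ k * F z) G)
      + d * H_inner (quad_weight P S) F G"
    and "H_inner (quad_weight P S) F (first_order_op a b d G) =
      (\<Sum>k\<in>UNIV. cnj (a $ k) * H_inner (quad_weight P S) F (partial_deriv k G))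
      + (\<Sum>k\<in>UNIV. cnj (b $ k) * H_inner (quad_weight P S) F (\<lambda>z. z $ k * G z))
      + cnj d * H_inner (quad_weight P S) F G"
proof -
  define \<phi> where "\<phi> = quad_weight P S"
  define e where "e z = complex_of_real (exp (- 2 * \<phi> z))" for z
  have ct: "continuous_on UNIV \<phi>" unfolding \<phi>_def by (rule continuous_on_quad_weight)
  note dF = op_domainD[OF F, folded \<phi>_def] and dG = op_domainD[OF G, folded \<phi>_def]
  note int = integrable_H_inner[OF _ _ ct, folded e_def]
  have "first_order_op a b d F z * cnj (G z) * e z =
      (\<Sum>k\<in>UNIV. a $ k * (partial_deriv k F z * cnj (G z) * e z))
      + (\<Sum>k\<in>UNIV. b $ k * ((z $ k * F z) * cnj (G z) * e z)) + d * (F z * cnj (G z) * e z)" for z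
    by (simp add: first_order_op_def distrib_right sum_distrib_right mult.assoc)
  then show "H_inner (quad_weight P S) (first_order_op a b d F) G =
      (\<Sum>k\<in>UNIV. a $ k * H_inner (quad_weight P S) (partial_deriv k F) G)
      + (\<Sum>k\<in>UNIV. b $ k * H_inner (quad_weight P S) (\<lambda>z. z $ k * F z) G)
      + d * H_inner (quad_weight P S) F G"
    unfolding H_inner_def \<phi>_def[symmetric] e_def[symmetric]
    using int[OF dF(1) dG(1)] int[OF dF(2) dG(1)] int[OF dF(3) dG(1)] by simp
  have "F z * cnj (first_order_op a b d G z) * e z =
      (\<Sum>k\<in>UNIV. cnj (a $ k) * (F z * cnj (partial_deriv k G z) * e z))
      + (\<Sum>k\<in>UNIV. cnj (b $ k) * (F z * cnj (z $ k * G z) * e z)) + cnj d * (F z * cnj (G z) * e z)" for z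
    by (simp add: first_order_op_def distrib_left distrib_right sum_distrib_left sum_distrib_right mult_ac)
  then show "H_inner (quad_weight P S) F (first_order_op a b d G) =
      (\<Sum>k\<in>UNIV. cnj (a $ k) * H_inner (quad_weight P S) F (partial_deriv k G))
      + (\<Sum>k\<in>UNIV. cnj (b $ k) * H_inner (quad_weight P S) F (\<lambda>z. z $ k * G z))
      + cnj d * H_inner (quad_weight P S) F G"
    unfolding H_inner_def \<phi>_def[symmetric] e_def[symmetric]
    using int[OF dF(1) dG(1)] int[OF dF(1) dG(2)] int[OF dF(1) dG(3)] by simp
qed

lemma H_inner_commute: "cnj (H_inner \<phi> F G) = H_inner \<phi> G F"
proof -
  have "cnj (H_inner \<phi> F G) = (LINT z|lborel. cnj (F z * cnj (G z) * complex_of_real (exp (- 2 * \<phi> z))))"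
    by (simp only: H_inner_def Bochner_Integration.integral_cnj)
  also have "\<dots> = H_inner \<phi> G F"
    unfolding H_inner_def by (rule Bochner_Integration.integral_cong) (auto simp: mult_ac)
  finally show ?thesis .
qed

text \<open>Integration by parts for \<open>F\<close> moves the derivative to the vectors
  \<open>\<beta>\<close> and \<open>\<gamma>\<close>, but \<open>\<gamma>\<close> still has the
  coordinates on \<open>F\<close>. The same rule for \<open>G\<close> expresses
  \<open>\<delta>\<close> through \<open>\<gamma>\<close> and \<open>\<beta>\<close>; inverting
  \<open>cnj_mat P\<close> there eliminates \<open>\<gamma>\<close>. The matrix \<open>N\<close> is
  chosen so that \<open>cnj_mat N ** scale_mat 2 (cnj_mat P)\<close> is
  \<open>R + scale_mat 2 S\<close>.\<close>

lemma H_inner_Lambda_op: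
  fixes R :: "complex ^ 'n ^ 'n"
  defines "N \<equiv> scale_mat (1 / 2) (cnj_mat (R + scale_mat 2 S) ** V)"
  assumes F: "F \<in> op_domain (quad_weight P S)" and G: "G \<in> op_domain (quad_weight P S)"
  shows "H_inner (quad_weight P S) (Lambda_op R i F) G =
    H_inner (quad_weight P S) F
      (first_order_op (N $ i) ((scale_mat 2 (cnj_mat P) - scale_mat 2 (N ** S)) $ i) 0 G)"
proof -
  define h where "h = H_inner (quad_weight P S)"
  define \<alpha> where "\<alpha> = (\<chi> k. h (partial_deriv k F) G)"
  define \<beta> where "\<beta> = (\<chi> k. h F (\<lambda>z. z $ k * G z))"
  define \<gamma> where "\<gamma> = (\<chi> k. h (\<lambda>z. z $ k * F z) G)"
  define \<delta> where "\<delta> = (\<chi> k. h F (partial_deriv k G))"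
  have sv: "scale_mat x M *v y = x *s (M *v y)" for x and M :: "complex ^ 'n ^ 'n" and y
    by (simp add: vec_eq_iff matrix_vector_mult_def sum_distrib_left mult.assoc)
  have a: "\<alpha> = 2 *s (P *v \<beta>) + 2 *s (S *v \<gamma>)"
    using H_inner_partial_deriv[OF P S F G]
    by (simp add: vec_eq_iff \<alpha>_def \<beta>_def \<gamma>_def h_def matrix_vector_mult_def)
  \<comment> \<open>Integration by parts with \<open>F\<close> and \<open>G\<close> exchanged,
    conjugated.\<close>
  have d: "\<delta> = 2 *s (cnj_mat P *v \<gamma>) + 2 *s (cnj_mat S *v \<beta>)"
  proof -
    have "\<delta> $ k = cnj (h (partial_deriv k G) F)" for k
      by (simp add: \<delta>_def h_def H_inner_commute)
    then show ?thesis
      unfolding h_def H_inner_partial_deriv[OF P S G F]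
      by (simp add: vec_eq_iff \<beta>_def \<gamma>_def h_def matrix_vector_mult_def H_inner_commute)
  qed
  have cN: "cnj_mat N = scale_mat (1 / 2) ((R + scale_mat 2 S) ** cnj_mat V)"
    unfolding N_def by (simp add: vec_eq_iff matrix_matrix_mult_def)
  have cVP: "cnj_mat V ** cnj_mat P = mat 1"
    using arg_cong[OF V, of cnj_mat] by (simp add: cnj_mat_mult)
  have "H_inner (quad_weight P S) (Lambda_op R i F) G = (\<alpha> + R *v \<gamma>) $ i"
    unfolding Lambda_op_eq H_inner_first_order_op(1)[OF F G] sum_axis_mult
    by (simp add: \<alpha>_def \<gamma>_def h_def matrix_vector_mult_def)
  also have "\<alpha> + R *v \<gamma> = cnj_mat N *v \<delta> + cnj_mat (scale_mat 2 (cnj_mat P) - scale_mat 2 (N ** S)) *v \<beta>"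
  proof -
    have e1: "cnj_mat (scale_mat 2 (cnj_mat P) - scale_mat 2 (N ** S))
        = scale_mat 2 P - scale_mat 2 (cnj_mat N ** cnj_mat S)"
      by (simp add: vec_eq_iff cnj_mat_mult[symmetric])
    have e2: "cnj_mat N *v \<delta> = (R + scale_mat 2 S) *v \<gamma> + 2 *s (cnj_mat N *v (cnj_mat S *v \<beta>))"
    proof -
      have "cnj_mat N *v (2 *s (cnj_mat P *v \<gamma>)) = (R + scale_mat 2 S) *v \<gamma>"
      proof -
        have "cnj_mat N *v (2 *s (cnj_mat P *v \<gamma>))
            = (R + scale_mat 2 S) *v (cnj_mat V *v (cnj_mat P *v \<gamma>))"
          unfolding cN by (simp add: sv vec.scale matrix_vector_mul_assoc[symmetric])
        then show ?thesis by (simp add: matrix_vector_mul_assoc cVP matrix_mul_assoc[symmetric])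
      qed
      then show ?thesis
        unfolding d by (simp add: vec.add vec.scale)
    qed
    show ?thesis
      unfolding e1 e2 by (simp add: a sv matrix_vector_mult_add_rdistrib matrix_vector_mult_diff_rdistrib
          matrix_vector_mul_assoc algebra_simps)
  qed
  also have "\<dots> $ i = H_inner (quad_weight P S) F
      (first_order_op (N $ i) ((scale_mat 2 (cnj_mat P) - scale_mat 2 (N ** S)) $ i) 0 G)"
    unfolding H_inner_first_order_op(2)[OF F G]
    by (simp add: \<delta>_def \<beta>_def h_def matrix_vector_mult_def)
  finally show ?thesis .
qed

text \<open>The integration by parts formula provides a candidate. The difference of two candidates
  is a first-order operator orthogonal to all test pairs, so its coefficients vanish and the
  description by \<open>THE\<close> is legitimate.\<close>

lemma adjoint_Lambda_op:
  fixes R :: "complex ^ 'n ^ 'n"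
  defines "N \<equiv> scale_mat (1 / 2) (cnj_mat (R + scale_mat 2 S) ** V)"
  shows "adjoint_op (quad_weight P S) (Lambda_op R i) =
    first_order_op (N $ i) ((scale_mat 2 (cnj_mat P) - scale_mat 2 (N ** S)) $ i) 0"
    (is "_ = ?T")
  unfolding adjoint_op_def
proof (rule the_equality)
  show "(\<exists>a b d. ?T = first_order_op a b d) \<and>
    (\<forall>F\<in>op_domain (quad_weight P S). \<forall>G\<in>op_domain (quad_weight P S).
       H_inner (quad_weight P S) (Lambda_op R i F) G = H_inner (quad_weight P S) F (?T G))"
    using H_inner_Lambda_op[of _ _ R i] unfolding N_def by blast
next
  fix T assume T: "(\<exists>a b d. T = first_order_op a b d) \<and>
    (\<forall>F\<in>op_domain (quad_weight P S). \<forall>G\<in>op_domain (quad_weight P S).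
       H_inner (quad_weight P S) (Lambda_op R i F) G = H_inner (quad_weight P S) F (T G))"
  then obtain a b d where Td: "T = first_order_op a b d" by blast
  define a' where "a' = N $ i"
  define b' where "b' = (scale_mat 2 (cnj_mat P) - scale_mat 2 (N ** S)) $ i"
  have "H_inner (quad_weight P S) F (first_order_op (a - a') (b - b') d G) = 0"
    if F: "F \<in> op_domain (quad_weight P S)" and G: "G \<in> op_domain (quad_weight P S)" for F G
  proof -
    have "H_inner (quad_weight P S) F (first_order_op a b d G)
        = H_inner (quad_weight P S) F (first_order_op a' b' 0 G)"
      using T F G H_inner_Lambda_op[OF F G, of R i] unfolding Td N_def[symmetric] a'_def b'_def by metis
    then show ?thesis
      unfolding H_inner_first_order_op(2)[OF F G]
      by (simp add: sum_subtractf algebra_simps)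
  qed
  from first_order_op_coeffs_zero[OF c pos this]
  show "T = ?T" unfolding Td a'_def[symmetric] b'_def[symmetric] by auto
qed

text \<open>Each commutator is an entry of one matrix, with indices \<open>j\<close> and
  \<open>i\<close> in swapped order, which is harmless because the prescribed values form a multiple
  of the identity. The symmetry of \<open>S\<close> combines the two terms containing
  \<open>N\<close> into \<open>N ** transpose M\<close>.\<close>

lemma is_scalar_commutator_adjoint:
  fixes R :: "complex ^ 'n ^ 'n"
  defines "M \<equiv> R + scale_mat 2 S"
  shows "(\<forall>i j. is_scalar_op (commutator (Lambda_op R i) (adjoint_op (quad_weight P S) (Lambda_op R j)))
        (if i = j then r else 0)) \<longleftrightarrow>
     scale_mat 2 (cnj_mat P) - scale_mat (1 / 2) (cnj_mat M ** V ** transpose M) = mat r"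
proof -
  define N where "N = scale_mat (1 / 2) (cnj_mat M ** V)"
  have 1: "(\<Sum>k\<in>UNIV. axis i (1 :: complex) $ k * b $ k) = b $ i" for i :: 'n and b
    by (simp add: sum_axis_mult)
  have 2: "(\<Sum>k\<in>UNIV. N $ j $ k * R $ i $ k) = (N ** transpose R) $ j $ i" for i j
    by (simp add: matrix_matrix_mult_def transpose_def)
  have "is_scalar_op (commutator (Lambda_op R i) (adjoint_op (quad_weight P S) (Lambda_op R j))) x \<longleftrightarrow>
      (scale_mat 2 (cnj_mat P) - scale_mat 2 (N ** S) - N ** transpose R) $ j $ i = x" for i j x
    unfolding adjoint_Lambda_op Lambda_op_eq[of R i] is_scalar_commutator_first_order_op
      M_def[symmetric] N_def[symmetric] 1 2 by simp
  moreover have "scale_mat 2 (N ** S) + N ** transpose R = scale_mat (1 / 2) (cnj_mat M ** V ** transpose M)"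
  proof -
    have "transpose M = transpose R + scale_mat 2 S"
      by (simp add: M_def transpose_add transpose_scale S)
    then have "N ** transpose M = N ** transpose R + scale_mat 2 (N ** S)"
      by (simp add: matrix_add_ldistrib)
        (simp add: vec_eq_iff matrix_matrix_mult_def sum_distrib_left mult_ac)
    moreover have "N ** transpose M = scale_mat (1 / 2) (cnj_mat M ** V ** transpose M)"
      unfolding N_def by (simp add: vec_eq_iff matrix_matrix_mult_def[of _ "transpose M"] sum_distrib_left mult_ac)
    ultimately show ?thesis by (simp add: add.commute)
  qed
  then have "scale_mat 2 (cnj_mat P) - scale_mat 2 (N ** S) - N ** transpose R =
      scale_mat 2 (cnj_mat P) - scale_mat (1 / 2) (cnj_mat M ** V ** transpose M)"
    by (simp add: diff_diff_eq)
  ultimately show ?thesis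
    by (auto simp add: vec_eq_iff[of _ "mat r"] vec_eq_iff mat_def)
qed

end

section \<open>The annihilation and commutation conditions on \<open>R\<close>\<close>

lemma Lambda_op_psi0:
  fixes Q R :: "complex ^ 'n ^ 'n"
  assumes Q: "transpose Q = Q"
  shows "(\<forall>i z. Lambda_op R i (psi0 Q) z = 0) \<longleftrightarrow> R = scale_mat 2 Q"
proof -
  have "((\<lambda>z. - bilin z (Q *v z)) has_derivative (\<lambda>v. - (bilin z (Q *v v) + bilin v (Q *v z)))) (at z)" for z
    by (intro has_derivative_minus has_derivative_bilin has_derivative_ident
        bounded_linear.has_derivative[OF bounded_linear_mult_vec])
  moreover have "(\<lambda>v. - (bilin z (Q *v v) + bilin v (Q *v z))) = (\<lambda>v. - 2 * bilin v (Q *v z))" for z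
  proof
    fix v
    have "bilin z (Q *v v) = bilin v (Q *v z)"
      by (metis Q bilin_commute bilin_mult_vec transpose_matrix_vector)
    then show "- (bilin z (Q *v v) + bilin v (Q *v z)) = - 2 * bilin v (Q *v z)" by simp
  qed
  ultimately have d: "((\<lambda>z. - bilin z (Q *v z)) has_derivative (\<lambda>v. - 2 * bilin v (Q *v z))) (at z)" for z
    by simp
  have "(psi0 Q has_derivative (\<lambda>v. exp (- bilin z (Q *v z)) * (- 2 * bilin v (Q *v z)))) (at z)" for z
    unfolding psi0_def
    by (rule has_derivative_compose[OF d])
       (use DERIV_exp[of "- bilin z (Q *v z)"] in \<open>simp add: has_field_derivative_def\<close>)
  then have "(psi0 Q has_derivative (\<lambda>v. \<Sum>k\<in>UNIV. v $ k * (- 2 * (Q *v z) $ k * psi0 Q z))) (at z)" for z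
    by (simp add: bilin_def sum_distrib_left psi0_def mult_ac)
  from partial_deriv_eqI[OF this]
  \<comment> \<open>On \<open>psi0 Q\<close>, which has no zeros, the operators act as
    multiplication by the components of a linear map; that map must vanish.\<close>
  have L: "Lambda_op R i (psi0 Q) z = ((R - scale_mat 2 Q) *v z) $ i * psi0 Q z" for i z
    by (simp add: Lambda_op_def matrix_vector_mult_def left_diff_distrib right_diff_distrib
        sum_subtractf sum_negf sum_distrib_left sum_distrib_right mult_ac)
  have nz: "psi0 Q z \<noteq> 0" for z by (simp add: psi0_def)
  show ?thesis
  proof
    assume "\<forall>i z. Lambda_op R i (psi0 Q) z = 0"
    then have "(R - scale_mat 2 Q) *v z = 0" for z
      by (simp add: L nz vec_eq_iff)
    then have "R - scale_mat 2 Q = 0" by (simp add: matrix_eq)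
    then show "R = scale_mat 2 Q" by simp
  next
    assume "R = scale_mat 2 Q"
    then show "\<forall>i z. Lambda_op R i (psi0 Q) z = 0" unfolding L by simp
  qed
qed

lemma commutator_Lambda_op:
  "is_scalar_op (commutator (Lambda_op R i) (Lambda_op R j)) 0 \<longleftrightarrow> R $ i $ j = R $ j $ i"
  unfolding Lambda_op_eq is_scalar_commutator_first_order_op sum_axis_mult by auto

subsection \<open>The equivalence\<close>

lemma pos_def_mat_invertible:
  fixes M :: "complex ^ 'n ^ 'n"
  assumes "pos_def_mat M"
  shows "invertible M"
proof -
  have "z = 0" if "M *v z = 0" for z
  proof (rule ccontr)
    assume "z \<noteq> 0"
    then have "0 < Re (bilin (cnj_vec z) (M *v z))" using assms by (simp add: pos_def_mat_def)
    then show False by (simp add: that bilin_def)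
  qed
  then show ?thesis
    by (simp add: invertible_left_inverse matrix_left_invertible_ker)
qed

lemma transpose_matrix_inv:
  fixes M :: "complex ^ 'n ^ 'n"
  assumes "invertible M" "transpose M = M"
  shows "transpose (matrix_inv M) = matrix_inv M"
proof -
  have i: "matrix_inv M ** M = mat 1" "M ** matrix_inv M = mat 1"
    using someI_ex[OF assms(1)[unfolded invertible_def]] by (simp_all add: matrix_inv_def)
  have "M ** transpose (matrix_inv M) = mat 1"
    using arg_cong[OF i(1), of transpose] by (simp add: matrix_transpose_mul assms(2) transpose_mat)
  then have "matrix_inv M ** (M ** transpose (matrix_inv M)) = matrix_inv M" by simp
  then show ?thesis by (simp add: matrix_mul_assoc i)
qed

text \<open>Symmetry of \<open>C\<close> passes to \<open>im_mat C\<close> and to its inverse, and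
  the product with \<open>B\<close> and \<open>transpose B\<close> on the two sides preserves
  it.\<close>

lemma transpose_Phi_zz:
  fixes A B C :: "complex ^ 'n ^ 'n"
  assumes "transpose A = A" "transpose C = C" "pos_def_mat (im_mat C)"
  shows "transpose (Phi_zz A B C) = Phi_zz A B C"
proof -
  have "transpose (im_mat C) = im_mat C"
    by (simp add: im_mat_def transpose_scale transpose_diff assms(2) cnj_mat_transpose[symmetric])
  then have "transpose (matrix_inv (im_mat C)) = matrix_inv (im_mat C)"
    using transpose_matrix_inv pos_def_mat_invertible[OF assms(3)] by blast
  then have "transpose (B ** matrix_inv (im_mat C) ** transpose B) = B ** matrix_inv (im_mat C) ** transpose B"
    by (simp add: matrix_transpose_mul matrix_mul_assoc)
  moreover have "transpose (- M) = - transpose M" for M :: "complex ^ 'n ^ 'n"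
    by (simp add: vec_eq_iff transpose_def)
  ultimately show ?thesis
    by (simp add: Phi_zz_def transpose_diff transpose_scale assms(1))
qed

section \<open>Properties of \<open>P\<close> read off from its diagonalisation\<close>

lemma spectral_form_hermitian:
  assumes "P = U ** diag_mat d ** conj_transpose U"
  shows "conj_transpose P = P"
  by (simp add: assms conj_transpose_def cnj_mat_mult cnj_mat_transpose matrix_transpose_mul
      matrix_mul_assoc)

text \<open>All eigenvalues are at least \<open>\<rho>\<^sup>2\<close>, and
  \<open>transpose U\<close> preserves the norm. This supplies the constant \<open>c\<close> of the
  Gaussian test functions.\<close>

lemma spectral_form_coercive:
  fixes U :: "complex ^ 'n ^ 'n"
  assumes U: "unitary_mat U" and P: "P = U ** diag_mat (\<lambda>i. (lam i)\<^sup>2) ** conj_transpose U"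
    and lam: "\<And>i. \<rho> \<le> lam i" and "0 \<le> \<rho>"
  shows "\<rho>\<^sup>2 * (norm z)\<^sup>2 \<le> Re (bilin z (P *v cnj_vec z))"
proof -
  define w where "w = transpose U *v z"
  have "unitary_mat (transpose U)"
    using unitary_mat_cnj[OF U] by (simp add: unitary_mat_def conj_transpose_def cnj_mat_transpose)
  then have "norm w = norm z" using unitary_norm[of "transpose U" z] by (simp add: w_def)
  then have "\<rho>\<^sup>2 * (norm z)\<^sup>2 = (\<Sum>i\<in>UNIV. \<rho>\<^sup>2 * (cmod (w $ i))\<^sup>2)"
    by (simp add: norm_vec_def L2_set_def sum_nonneg sum_distrib_left[symmetric])
  also have "\<dots> \<le> (\<Sum>i\<in>UNIV. (lam i)\<^sup>2 * (cmod (w $ i))\<^sup>2)"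
    using lam \<open>0 \<le> \<rho>\<close> by (intro sum_mono mult_right_mono power_mono) auto
  also have "\<dots> = (norm (diag_mat lam *v w))\<^sup>2"
    by (simp add: norm_vec_def L2_set_def sum_nonneg diag_mat_mult_vec norm_mult power_mult_distrib)
  also have "\<dots> = Re (bilin z (P *v cnj_vec z))"
    unfolding hermitian_form_spectral[OF P] w_def by simp
  finally show ?thesis .
qed

lemma spectral_form_inverse:
  fixes U :: "complex ^ 'n ^ 'n"
  assumes U: "unitary_mat U" and P: "P = U ** diag_mat d ** conj_transpose U"
    and d: "\<And>i. d i \<noteq> 0"
  shows "(U ** diag_mat (\<lambda>i. 1 / d i) ** conj_transpose U) ** P = mat 1"
proof -
  have u: "conj_transpose U ** U = mat 1" "U ** conj_transpose U = mat 1"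
    using U by (simp_all add: unitary_mat_def)
  have dd: "diag_mat (\<lambda>i. 1 / d i) ** diag_mat d = mat 1"
    using d by (simp add: diag_mult_diag diag_mat_const)
  show ?thesis
    by (simp add: P matrix_mul_assoc[symmetric] matrix_cancel_left[OF u(1)]
        matrix_cancel_left[OF dd] u)
qed

text \<open>Annihilation forces \<open>R = scale_mat 2 Q\<close>, which is symmetric, so the
  commutation relations hold. Then \<open>R + scale_mat 2 S\<close> is twice \<open>S + Q\<close>,
  and the relation with the adjoints is twice the Riccati equation.\<close>

lemma condition2_iff:
  fixes P S Q R V :: "complex ^ 'n ^ 'n"
  assumes "c > 0" and "\<And>z. c * (norm z)\<^sup>2 \<le> Re (bilin z (P *v cnj_vec z))"
    and "conj_transpose P = P" and S: "transpose S = S" and "V ** P = mat 1"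
    and Q: "transpose Q = Q"
  shows "condition2 (quad_weight P S) \<rho> Q R \<longleftrightarrow> R = scale_mat 2 Q \<and>
    cnj_mat (S + Q) ** V ** (S + Q) = cnj_mat P - mat ((complex_of_real \<rho>)\<^sup>2)"
proof -
  define T where "T = S + Q"
  have "condition2 (quad_weight P S) \<rho> Q R \<longleftrightarrow> R = scale_mat 2 Q \<and> (\<forall>i j. R $ i $ j = R $ j $ i) \<and>
     scale_mat 2 (cnj_mat P) - scale_mat (1 / 2)
       (cnj_mat (R + scale_mat 2 S) ** V ** transpose (R + scale_mat 2 S)) = mat (2 * (complex_of_real \<rho>)\<^sup>2)"
    unfolding condition2_def Lambda_op_psi0[OF Q] commutator_Lambda_op
      is_scalar_commutator_adjoint[OF assms(1-5)] ..
  moreover have "scale_mat 2 Q $ i $ j = scale_mat 2 Q $ j $ i" for i j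
  proof -
    have "Q $ i $ j = transpose Q $ j $ i" by (simp add: transpose_def)
    then show ?thesis by (simp add: Q)
  qed
  moreover have "scale_mat 2 Q + scale_mat 2 S = scale_mat 2 T"
    by (simp add: vec_eq_iff T_def distrib_left add.commute)
  moreover have "transpose T = T" by (simp add: T_def transpose_add S Q)
  moreover have "scale_mat 2 (cnj_mat P) - scale_mat (1 / 2) (cnj_mat (scale_mat 2 T) ** V ** scale_mat 2 T)
        = mat (2 * (complex_of_real \<rho>)\<^sup>2) \<longleftrightarrow>
      cnj_mat T ** V ** T = cnj_mat P - mat ((complex_of_real \<rho>)\<^sup>2)"
  proof -
    let ?W = "cnj_mat T ** V ** T"
    have "scale_mat (1 / 2) (cnj_mat (scale_mat 2 T) ** V ** scale_mat 2 T) = scale_mat 2 ?W"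
      by (simp add: vec_eq_iff matrix_matrix_mult_def sum_distrib_left sum_distrib_right mult_ac)
    moreover have "scale_mat 2 (cnj_mat P) - scale_mat 2 ?W = mat (2 * (complex_of_real \<rho>)\<^sup>2)
        \<longleftrightarrow> scale_mat 2 ?W = scale_mat 2 (cnj_mat P - mat ((complex_of_real \<rho>)\<^sup>2))"
    proof -
      have "(mat (2 * (complex_of_real \<rho>)\<^sup>2) :: complex ^ 'n ^ 'n)
          = scale_mat 2 (mat ((complex_of_real \<rho>)\<^sup>2))"
        by (simp add: vec_eq_iff mat_def)
      moreover have "scale_mat 2 (X - Y) = scale_mat 2 X - scale_mat 2 Y" for X Y :: "complex ^ 'n ^ 'n"
        by (simp add: vec_eq_iff right_diff_distrib)
      moreover have "a - b = r \<longleftrightarrow> b = a - r" for a b r :: "complex ^ 'n ^ 'n"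
        by (auto simp: algebra_simps)
      ultimately show ?thesis by simp
    qed
    moreover have "scale_mat 2 X = scale_mat 2 Y \<longleftrightarrow> X = Y" for X Y :: "complex ^ 'n ^ 'n"
      by (simp add: vec_eq_iff)
    ultimately show ?thesis by simp
  qed
  ultimately show ?thesis
    unfolding T_def[symmetric] by (auto simp: transpose_scale)
qed

theorem theorem6:
  fixes A B C U Q :: "complex ^ 'n ^ 'n"
    and lam \<mu> :: "'n \<Rightarrow> real"
    and \<rho> :: real
  assumes "transpose A = A"
    and "det B \<noteq> 0"
    and "transpose C = C"
    and "pos_def_mat (im_mat C)"
    and "\<And>i. lam i > 0"
    and "unitary_mat U"
    and "conj_transpose U ** Phi_zzbar B C ** U = diag_mat (\<lambda>i. (lam i)\<^sup>2)"
    and "0 < \<rho>" and "\<rho> < Min (range lam)"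
    and "\<And>i. \<mu> i = sqrt ((lam i)\<^sup>2 - \<rho>\<^sup>2)"
    and "transpose Q = Q"
  shows "((\<exists>R :: complex ^ 'n ^ 'n.
             condition1 (Phi_zzbar B C) (Phi_zz A B C) Q \<and> condition2 (Phi A B C) \<rho> Q R)
          \<longleftrightarrow>
          (\<exists>X :: complex ^ 'n ^ 'n.
             unitary_mat X \<and>
             transpose X ** diag_mat (\<lambda>i. \<mu> i / lam i) = diag_mat (\<lambda>i. \<mu> i / lam i) ** X \<and>
             Q = - Phi_zz A B C + U ** diag_mat \<mu> ** X ** diag_mat lam ** transpose U))
         \<and>
         (\<forall>R :: complex ^ 'n ^ 'n.
             condition1 (Phi_zzbar B C) (Phi_zz A B C) Q \<and> condition2 (Phi A B C) \<rho> Q R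
             \<longrightarrow> R = scale_mat 2 Q)"
proof -
  define P where "P = Phi_zzbar B C"
  define S where "S = Phi_zz A B C"
  \<comment> \<open>The inverse of \<open>P\<close>, written in the eigenbasis.\<close>
  define V where "V = U ** diag_mat (\<lambda>i. 1 / (lam i)\<^sup>2) ** conj_transpose U"
  note U = assms(6) and \<rho> = assms(8)
  have lam\<rho>: "\<rho> < lam i" for i
    using assms(9) by (simp add: Min_gr_iff)
  have \<mu>2: "(\<mu> i)\<^sup>2 = (lam i)\<^sup>2 - \<rho>\<^sup>2" and \<mu>: "\<mu> i > 0" for i
  proof -
    have "\<rho>\<^sup>2 < (lam i)\<^sup>2" using \<rho> lam\<rho>[of i] by (intro power_strict_mono) auto
    then show "(\<mu> i)\<^sup>2 = (lam i)\<^sup>2 - \<rho>\<^sup>2" "\<mu> i > 0" by (simp_all add: assms(10))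
  qed
  have P: "P = U ** diag_mat (\<lambda>i. (lam i)\<^sup>2) ** conj_transpose U"
    unfolding P_def by (rule spectral_form[OF U assms(7)])
  have S: "transpose S = S"
    unfolding S_def by (rule transpose_Phi_zz[OF assms(1,3,4)])
  have V: "V ** P = mat 1"
    unfolding V_def by (rule spectral_form_inverse[OF U P]) (use assms(5) in \<open>simp add: less_imp_neq[symmetric]\<close>)
  have coer: "\<rho>\<^sup>2 * (norm z)\<^sup>2 \<le> Re (bilin z (P *v cnj_vec z))" for z
    by (rule spectral_form_coercive[OF U P]) (use \<rho> lam\<rho> in \<open>auto intro: less_imp_le\<close>)
  have \<phi>: "Phi A B C = quad_weight P S"
    by (simp add: fun_eq_iff Phi_def quad_weight_def P_def S_def)
  have T: "transpose (S + Q) = S + Q"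
    by (simp add: transpose_add S assms(11))
  have c2: "condition2 (Phi A B C) \<rho> Q R \<longleftrightarrow> R = scale_mat 2 Q \<and>
      cnj_mat (S + Q) ** V ** (S + Q) = cnj_mat P - mat ((complex_of_real \<rho>)\<^sup>2)" for R
    unfolding \<phi>
    by (rule condition2_iff[OF _ coer spectral_form_hermitian[OF P] S V assms(11)]) (use \<rho> in simp)
  have Q: "Q = - S + Y \<longleftrightarrow> S + Q = Y" for Y
    by (auto simp: algebra_simps)
  show ?thesis
    \<comment> \<open>Both assertions are now statements about the Riccati equation. The factor
      \<open>X\<close> that it provides yields Condition 1 for the direction from (B) to (A), and
      \<open>c2\<close> contains the value of \<open>R\<close>.\<close>
    unfolding c2 P_def[symmetric] S_def[symmetric] Q
      riccati_iff_unitary_factor[OF U P V assms(5) \<mu> \<mu>2 T, symmetric]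
    using condition1_of_unitary_factor[OF U _ P _ \<mu>2 \<rho>] by blast
qed

end
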